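(* Let $D=(V,A)$ be a directed graph with $n=|V|$ and $m=|A|$, $s,t\in V$, $c:A\to\mathbb{R}_{\geq 0}$, and $k\geq 2$ an integer such that $D$ contains at least $k$ simple $s$-$t$-paths. The $k$-Shortest Simple Path problem on $(D,s,t,c,k)$ can be solved (by the Roditty–Zwick scheme using $\text{BDA}_{2\text{SSP}}$ for its second-shortest-simple-path subproblems) in time $\mathcal{O}(kn(n\log n+m))$.
   Context: The $k$-Shortest Simple Path problem asks for a sequence $(p_1,\dots,p_k)$ of pairwise distinct simple $s$-$t$-paths with $c(p_i)\leq c(p_{i+1})$ for all $i$, such that no simple $s$-$t$-path outside the sequence has cost strictly less than $c(p_k)$; the cost of a path is the sum of its arc costs. The algorithm computes $p_1$ by a shortest path computation, and then in each of $k-1$ iterations extracts a cheapest candidate path from a priority queue and performs at most two second-shortest-simple-path computations (on suitable subgraphs obtained by deleting a prefix of a path and some blocked deviation arcs), each done with $\text{BDA}_{2\text{SSP}}$: the One-to-One Biobjective Dijkstra Algorithm run with the cost pair (original cost, indicator of lying on the current path), stopped as soon as an efficient path to $t$ using fewer arcs of the current path than the current path itself is extracted. *)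

theory Defs
  imports
    "Graph_Theory.Graph_Theory"
    "HOL-Library.Monad_Syntax"
    "HOL-Library.While_Combinator"
    "HOL-Library.Log_Nat"
begin

section \<open>The problem\<close>

text \<open>
  Digraphs, simple paths (\<^const>\<open>pre_digraph.apath\<close>, lists of arcs) and path costs are those of
  the entry Graph_Theory.
\<close>

definition is_kssp_solution ::
  "('v, 'a) pre_digraph \<Rightarrow> ('a \<Rightarrow> real) \<Rightarrow> 'v \<Rightarrow> 'v \<Rightarrow> nat \<Rightarrow> 'a list list \<Rightarrow> bool" where
  "is_kssp_solution G c s t k ps \<longleftrightarrow>
     length ps = k \<and> distinct ps \<and>
     (\<forall>p\<in>set ps. pre_digraph.apath G s p t) \<and>
     (\<forall>i. Suc i < k \<longrightarrow>
        wf_digraph.awalk_cost c (ps ! i) \<le> wf_digraph.awalk_cost c (ps ! Suc i)) \<and>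
     \<not> (\<exists>q. pre_digraph.apath G s q t \<and> q \<notin> set ps \<and>
           wf_digraph.awalk_cost c q < wf_digraph.awalk_cost c (ps ! (k - 1)))"


section \<open>Computations that count their steps\<close>

text \<open>
  \<open>Halts x n\<close> is a computation that returns \<open>x\<close> after \<open>n\<close> steps.  The cost model is a unit-cost
  RAM with exact arithmetic on reals.  Every loop iteration is charged one step; for this to be
  proportional to the real effort, the expressions evaluated between two charges must be
  of constant size and consist of arithmetic and comparisons, construction and matching of
  tuples, options and list cells (lists are linked lists, tails are shared), and
  array accesses.  Arrays indexed by vertices or arcs are functions, an update
  \<open>f(x := y)\<close> costs \<open>O(1)\<close>, and all of them are used single-threadedly, so that
  the updates can be done in place.  Creating an array is charged its size.
\<close>

datatype 'a timed = Halts 'a nat | Diverges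

fun bind_timed :: "'a timed \<Rightarrow> ('a \<Rightarrow> 'b timed) \<Rightarrow> 'b timed" where
  "bind_timed (Halts x m) f = (case f x of Halts y n \<Rightarrow> Halts y (m + n) | Diverges \<Rightarrow> Diverges)"
| "bind_timed Diverges f = Diverges"

adhoc_overloading Monad_Syntax.bind \<rightleftharpoons> bind_timed

definition ret :: "'a \<Rightarrow> 'a timed" where
  "ret x = Halts x 0"

definition tick :: "nat \<Rightarrow> unit timed" where
  "tick n = Halts () n"

primrec foreach :: "'x list \<Rightarrow> ('x \<Rightarrow> 's \<Rightarrow> 's timed) \<Rightarrow> 's \<Rightarrow> 's timed" where
  "foreach [] f s = ret s"
| "foreach (x # xs) f s = do { tick 1; s' \<leftarrow> f x s; foreach xs f s' }"

definition while_timed :: "('s \<Rightarrow> bool) \<Rightarrow> ('s \<Rightarrow> 's timed) \<Rightarrow> 's \<Rightarrow> 's timed" where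
  "while_timed b f s =
     (case while_option
             (\<lambda>r. case r of Halts s' _ \<Rightarrow> b s' | Diverges \<Rightarrow> False)
             (\<lambda>r. do { s' \<leftarrow> r; tick 1; f s' })
             (ret s)
      of Some r \<Rightarrow> r | None \<Rightarrow> Diverges)"

definition new_array :: "'x list \<Rightarrow> 'e \<Rightarrow> ('x \<Rightarrow> 'e) timed" where
  "new_array xs e = do { tick (length xs); ret (\<lambda>_. e) }"


section \<open>Priority queues\<close>

text \<open>
  A queue holds at most one entry per item; keys are pairs, ordered lexicographically.
  As usual for Dijkstra-type algorithms, the operations are charged the amortized costs of
  a Fibonacci heap, starting from an empty one: \<open>O(1)\<close> for insertion and for decreasing a key
  (both are \<open>pq_put\<close>) and \<open>O(log N)\<close> for the extraction of a minimum from \<open>N\<close> entries.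
  Looking up the entry of an item and testing for emptiness are \<open>O(1)\<close> expressions.
  Ties are broken arbitrarily.
\<close>

type_synonym ('i, 'e) pq = "'i \<Rightarrow> 'e option"

definition lex_less :: "real \<times> nat \<Rightarrow> real \<times> nat \<Rightarrow> bool" where
  "lex_less x y \<longleftrightarrow> fst x < fst y \<or> (fst x = fst y \<and> snd x < snd y)"

definition pq_empty :: "('i, 'e) pq" where
  "pq_empty = (\<lambda>_. None)"

definition pq_is_empty :: "('i, 'e) pq \<Rightarrow> bool" where
  "pq_is_empty Q \<longleftrightarrow> Q = pq_empty"

definition pq_put :: "'i \<Rightarrow> 'e \<Rightarrow> ('i, 'e) pq \<Rightarrow> ('i, 'e) pq timed" where
  "pq_put i e Q = do { tick 1; ret (Q(i := Some e)) }"

definition pq_min :: "('e \<Rightarrow> real \<times> nat) \<Rightarrow> ('i, 'e) pq \<Rightarrow> 'i" where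
  "pq_min key Q =
     (SOME i. i \<in> dom Q \<and> (\<forall>j\<in>dom Q. \<not> lex_less (key (the (Q j))) (key (the (Q i)))))"

definition pq_extract_min ::
  "('e \<Rightarrow> real \<times> nat) \<Rightarrow> ('i, 'e) pq \<Rightarrow> ('i \<times> 'e \<times> ('i, 'e) pq) timed" where
  "pq_extract_min key Q =
     (let i = pq_min key Q
      in do { tick (1 + floorlog 2 (card (dom Q))); ret (i, the (Q i), Q(i := None)) })"


section \<open>Subgraphs in adjacency list representation\<close>

record ('v, 'a) adj_graph =
  av :: "'v list"
  aa :: "'a list"
  aout :: "'v \<Rightarrow> 'a list"
  ain :: "'v \<Rightarrow> 'a list"

text \<open>
  The subgraph given by the vertices \<open>vs\<close> and arcs \<open>es\<close> of \<open>G\<close>, without the tails of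
  the arcs in \<open>pre\<close> and without the arcs in \<open>blocked\<close>.  If \<open>pre\<close> is a simple path, its
  tails are all of its vertices but the last one.
\<close>

definition subgraph_adj ::
  "('v, 'a) pre_digraph \<Rightarrow> 'v list \<Rightarrow> 'a list \<Rightarrow> 'a list \<Rightarrow> 'a list \<Rightarrow> ('v, 'a) adj_graph timed" where
  "subgraph_adj G vs es pre blocked = do {
     dv \<leftarrow> new_array vs False;
     dv \<leftarrow> foreach pre (\<lambda>a dv. ret (dv(tail G a := True))) dv;
     da \<leftarrow> new_array es False;
     da \<leftarrow> foreach blocked (\<lambda>a da. ret (da(a := True))) da;
     vs' \<leftarrow> foreach vs (\<lambda>v ws. ret (if dv v then ws else v # ws)) [];
     os \<leftarrow> new_array vs [];
     is \<leftarrow> new_array vs [];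
     (es', os, is) \<leftarrow> foreach es (\<lambda>a (es', os, is).
       ret (if da a \<or> dv (tail G a) \<or> dv (head G a) then (es', os, is)
            else (a # es',
                  os(tail G a := a # os (tail G a)),
                  is(head G a := a # is (head G a))))) ([], os, is);
     ret \<lparr> av = vs', aa = es', aout = os, ain = is \<rparr> }"


section \<open>The biobjective Dijkstra algorithm\<close>

text \<open>
  A label of a vertex \<open>v\<close> represents a path to \<open>v\<close>: its two costs (original cost and number
  of arcs marked by \<open>on\<close>) and its arcs in reverse order.
\<close>

type_synonym 'a label = "real \<times> nat \<times> 'a list"

definition label_key :: "'a label \<Rightarrow> real \<times> nat" where
  "label_key l = (fst l, fst (snd l))"

definition extend_label :: "('a \<Rightarrow> real) \<Rightarrow> ('a \<Rightarrow> bool) \<Rightarrow> 'a \<Rightarrow> 'a label \<Rightarrow> 'a label" where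
  "extend_label c on a l =
     (case l of (x, g, p) \<Rightarrow> (x + c a, (if on a then g + 1 else g), a # p))"

text \<open>
  \<open>L\<close> is the list of permanent labels of a vertex in the order of their extraction.  It is
  increasing in the first and strictly decreasing in the second cost, and labels are found in
  lexicographic order, so a new label is dominated by \<open>L\<close> iff it is dominated in the second
  cost by the last element of \<open>L\<close>.  These lists are only extended at their end and accessed by
  index; they are dynamic arrays, for which \<open>length\<close>, \<open>!\<close>, \<open>last\<close> and appending an element
  cost \<open>O(1)\<close>.
\<close>

definition dominated :: "'a label list \<Rightarrow> 'a label \<Rightarrow> bool" where
  "dominated L l \<longleftrightarrow> L \<noteq> [] \<and> fst (snd (last L)) \<le> fst (snd l)"

text \<open>
  The lexicographically least extension, along an arc into \<open>v\<close>, of a permanent label that is not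
  dominated at \<open>v\<close>.  For each arc \<open>a\<close>, the permanent labels of its tail
  before position \<open>nx a\<close> have dominated extensions and are not inspected again.
\<close>

definition next_candidate ::
  "('v, 'a) pre_digraph \<Rightarrow> ('a \<Rightarrow> real) \<Rightarrow> ('v, 'a) adj_graph \<Rightarrow> ('a \<Rightarrow> bool) \<Rightarrow>
   ('v \<Rightarrow> 'a label list) \<Rightarrow> 'v \<Rightarrow> ('a \<Rightarrow> nat) \<Rightarrow> ('a label option \<times> ('a \<Rightarrow> nat)) timed" where
  "next_candidate G c H on perm v nx =
     foreach (ain H v) (\<lambda>a (best, nx). do {
       let L = perm (tail G a);
       let ext = (\<lambda>i. extend_label c on a (L ! i));
       i \<leftarrow> while_timed (\<lambda>i. i < length L \<and> dominated (perm v) (ext i)) (\<lambda>i. ret (i + 1)) (nx a);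
       ret (if i < length L \<and>
               (case best of None \<Rightarrow> True | Some b \<Rightarrow> lex_less (label_key (ext i)) (label_key b))
            then Some (ext i) else best,
            nx(a := i)) }) (None, nx)"

definition propagate ::
  "('v, 'a) pre_digraph \<Rightarrow> ('a \<Rightarrow> real) \<Rightarrow> ('v, 'a) adj_graph \<Rightarrow> ('a \<Rightarrow> bool) \<Rightarrow>
   ('v \<Rightarrow> 'a label list) \<Rightarrow> 'v \<Rightarrow> 'a label \<Rightarrow> ('v, 'a label) pq \<Rightarrow> ('v, 'a label) pq timed" where
  "propagate G c H on perm v l Q =
     foreach (aout H v) (\<lambda>a Q. do {
       let w = head G a;
       let l' = extend_label c on a l;
       if \<not> dominated (perm w) l' \<and>
          (case Q w of None \<Rightarrow> True | Some b \<Rightarrow> lex_less (label_key l') (label_key b))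
       then pq_put w l' Q else ret Q }) Q"

text \<open>
  The one-to-one search from \<open>s\<close> to \<open>t\<close>.  It stops with the first extracted label of \<open>t\<close> whose
  second cost is less than \<open>g\<close>; the result is \<open>None\<close> if there is none.
\<close>

definition bda ::
  "('v, 'a) pre_digraph \<Rightarrow> ('a \<Rightarrow> real) \<Rightarrow> ('v, 'a) adj_graph \<Rightarrow> ('a \<Rightarrow> bool) \<Rightarrow> nat \<Rightarrow> 'v \<Rightarrow> 'v \<Rightarrow>
   (real \<times> 'a list) option timed" where
  "bda G c H on g s t = do {
     perm \<leftarrow> new_array (av H) [];
     nx \<leftarrow> new_array (aa H) 0;
     _ \<leftarrow> new_array (av H) ();  \<comment> \<open>the positions of the vertices in the queue\<close>
     Q \<leftarrow> pq_put s (0, 0, []) pq_empty;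
     (perm, nx, Q, res) \<leftarrow> while_timed
       (\<lambda>(perm, nx, Q, res). res = None \<and> \<not> pq_is_empty Q)
       (\<lambda>(perm, nx, Q, res). do {
          (v, l, Q) \<leftarrow> pq_extract_min label_key Q;
          let perm = perm(v := perm v @ [l]);
          if v = t \<and> fst (snd l) < g then ret (perm, nx, Q, Some l)
          else do {
            (best, nx) \<leftarrow> next_candidate G c H on perm v nx;
            Q \<leftarrow> (case best of None \<Rightarrow> ret Q | Some b \<Rightarrow> pq_put v b Q);
            Q \<leftarrow> propagate G c H on perm v l Q;
            ret (perm, nx, Q, None) } })
       (perm, nx, Q, None);
     case res of
       None \<Rightarrow> ret None
     | Some l \<Rightarrow> do {
         p \<leftarrow> foreach (snd (snd l)) (\<lambda>a p. ret (a # p)) [];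
         ret (Some (fst l, p)) } }"

text \<open>With no arc marked, the second cost vanishes and the search is Dijkstra's algorithm.\<close>

definition shortest_path ::
  "('v, 'a) pre_digraph \<Rightarrow> ('a \<Rightarrow> real) \<Rightarrow> ('v, 'a) adj_graph \<Rightarrow> 'v \<Rightarrow> 'v \<Rightarrow>
   (real \<times> 'a list) option timed" where
  "shortest_path G c H s t = do {
     on \<leftarrow> new_array (aa H) False;
     bda G c H on 1 s t }"

text \<open>A second shortest simple path, given a shortest path \<open>p\<close> from \<open>s\<close> to \<open>t\<close> in \<open>H\<close>.\<close>

definition bda_2ssp ::
  "('v, 'a) pre_digraph \<Rightarrow> ('a \<Rightarrow> real) \<Rightarrow> ('v, 'a) adj_graph \<Rightarrow> 'v \<Rightarrow> 'v \<Rightarrow> 'a list \<Rightarrow>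
   (real \<times> 'a list) option timed" where
  "bda_2ssp G c H s t p = do {
     on \<leftarrow> new_array (aa H) False;
     (on, g) \<leftarrow> foreach p (\<lambda>a (on, g). ret (on(a := True), g + 1)) (on, 0);
     bda G c H on g s t }"


section \<open>The Roditty-Zwick scheme\<close>

text \<open>
  A subproblem consists of a prefix path from \<open>s\<close> to a vertex \<open>source\<close> (arcs in reverse
  order, and cost), a shortest path \<open>suffix\<close> from there to \<open>t\<close> that avoids the other vertices
  of the prefix, and a list of arcs by which a path must not deviate from \<open>suffix\<close> since the
  cheapest path doing so has already been found.  A candidate is a subproblem together
  with a second shortest path for it.
\<close>

record ('v, 'a) subproblem =
  rev_prefix :: "'a list"
  prefix_cost :: real
  source :: 'v
  suffix :: "'a list"
  blocked :: "'a list"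

type_synonym ('v, 'a) candidate = "real \<times> ('v, 'a) subproblem \<times> 'a list"

definition candidate_key :: "('v, 'a) candidate \<Rightarrow> real \<times> nat" where
  "candidate_key x = (fst x, 0)"

text \<open>
  Solves a subproblem and enqueues the result as item \<open>N\<close>, the number of candidates enqueued
  before.
\<close>

definition enqueue_second ::
  "('v, 'a) pre_digraph \<Rightarrow> ('a \<Rightarrow> real) \<Rightarrow> 'v list \<Rightarrow> 'a list \<Rightarrow> 'v \<Rightarrow> ('v, 'a) subproblem \<Rightarrow>
   (nat, ('v, 'a) candidate) pq \<times> nat \<Rightarrow> ((nat, ('v, 'a) candidate) pq \<times> nat) timed" where
  "enqueue_second G c vs es t P = (\<lambda>(Q, N). do {
     H \<leftarrow> subgraph_adj G vs es (rev_prefix P) (blocked P);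
     r \<leftarrow> bda_2ssp G c H (source P) t (suffix P);
     case r of
       None \<Rightarrow> ret (Q, N)
     | Some (x, q) \<Rightarrow> do {
         Q \<leftarrow> pq_put N (prefix_cost P + x, P, q) Q;
         ret (Q, N + 1) } })"

text \<open>
  Moves the common initial part of the suffix paths \<open>p\<close> and \<open>q\<close> to the prefix.  Returns the
  extended prefix, its cost, and the rest of \<open>q\<close>, which starts with the deviation arc.
\<close>

definition split_deviation ::
  "('a \<Rightarrow> real) \<Rightarrow> 'a list \<Rightarrow> real \<Rightarrow> 'a list \<Rightarrow> 'a list \<Rightarrow> ('a list \<times> real \<times> 'a list) timed" where
  "split_deviation c pre z p q = do {
     (pre, z, p, q) \<leftarrow> while_timed
       (\<lambda>(pre, z, p, q). p \<noteq> [] \<and> q \<noteq> [] \<and> hd p = hd q)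
       (\<lambda>(pre, z, p, q). ret (hd q # pre, z + c (hd q), tl p, tl q))
       (pre, z, p, q);
     ret (pre, z, q) }"

definition kssp_step ::
  "('v, 'a) pre_digraph \<Rightarrow> ('a \<Rightarrow> real) \<Rightarrow> 'v list \<Rightarrow> 'a list \<Rightarrow> 'v \<Rightarrow>
   'a list list \<times> (nat, ('v, 'a) candidate) pq \<times> nat \<Rightarrow>
   ('a list list \<times> (nat, ('v, 'a) candidate) pq \<times> nat) timed" where
  "kssp_step G c vs es t = (\<lambda>(ps, Q, N).
     if pq_is_empty Q then ret (ps, Q, N)
     else do {
       (_, (_, P, q), Q) \<leftarrow> pq_extract_min candidate_key Q;
       new \<leftarrow> foreach (rev_prefix P) (\<lambda>a r. ret (a # r)) q;
       (pre, z, q') \<leftarrow> split_deviation c (rev_prefix P) (prefix_cost P) (suffix P) q;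
       let d = hd q';
       (Q, N) \<leftarrow> enqueue_second G c vs es t (P\<lparr> blocked := d # blocked P \<rparr>) (Q, N);
       (Q, N) \<leftarrow> enqueue_second G c vs es t
         \<lparr> rev_prefix = d # pre, prefix_cost = z + c d, source = head G d,
           suffix = tl q', blocked = [] \<rparr> (Q, N);
       ret (new # ps, Q, N) })"

text \<open>The input digraph is given by lists of its vertices and arcs and the maps of \<open>G\<close>.\<close>

definition kssp ::
  "('v, 'a) pre_digraph \<Rightarrow> 'v list \<Rightarrow> 'a list \<Rightarrow> 'v \<Rightarrow> 'v \<Rightarrow> ('a \<Rightarrow> real) \<Rightarrow> nat \<Rightarrow>
   'a list list timed" where
  "kssp G vs es s t c k = do {
     H \<leftarrow> subgraph_adj G vs es [] [];
     r \<leftarrow> shortest_path G c H s t;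
     case r of
       None \<Rightarrow> ret []
     | Some (x, p) \<Rightarrow> do {
         (Q, N) \<leftarrow> enqueue_second G c vs es t
           \<lparr> rev_prefix = [], prefix_cost = 0, source = s, suffix = p, blocked = [] \<rparr>
           (pq_empty, 0);
         (_, ps, Q, N) \<leftarrow> while_timed (\<lambda>(i, _). i < k)
           (\<lambda>(i, st). do { st \<leftarrow> kssp_step G c vs es t st; ret (i + 1, st) })
           (1, [p], Q, N);
         foreach ps (\<lambda>p r. ret (p # r)) [] } }"

end

theory Submission
  imports Defs
begin

text \<open>
  The search extracts labels in lexicographic order, and the second costs of the labels of a vertex
  strictly decrease.  As labels represent simple paths, a vertex has at most \<open>n\<close> of them, which
  gives \<open>O(n (n log n + m))\<close> per search.  A simple path from \<open>u\<close> to \<open>t\<close> other than \<open>p\<close> misses an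
  arc of \<open>p\<close>, so the search with the arcs of \<open>p\<close> marked finds a second shortest simple path.

  A subproblem with suffix \<open>p\<close> stands for the paths through its prefix that first deviate from
  \<open>p\<close> by an arc that is not blocked.  If \<open>q\<close> is a cheapest one of them and deviates by \<open>d\<close>, the
  others either deviate by another arc, or they deviate by \<open>d\<close> and then differ from \<open>q\<close>; these are
  the paths of the two new subproblems.  So the \<open>s\<close>-\<open>t\<close>-paths are always partitioned into those
  returned and those of the subproblems in the queue.  The queue has at most \<open>2k\<close> entries, and
  \<open>log k \<le> mn\<close> since there are at most \<open>(m + 1)\<^sup>n\<close> simple paths.
\<close>

declare split_paired_Ex [simp del] split_paired_All [simp del]

section \<open>Total correctness with running times\<close>

definition spec :: "'a timed \<Rightarrow> ('a \<Rightarrow> nat \<Rightarrow> bool) \<Rightarrow> bool" where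
  "spec m P \<longleftrightarrow> (\<exists>x n. m = Halts x n \<and> P x n)"

lemma spec_ret [simp]: "spec (ret x) P \<longleftrightarrow> P x 0"
  by (simp add: spec_def ret_def)

lemma spec_tick [simp]: "spec (tick n) P \<longleftrightarrow> P () n"
  by (simp add: spec_def tick_def)

lemma spec_bind [simp]:
  "spec (bind_timed m f) P \<longleftrightarrow> spec m (\<lambda>x n. spec (f x) (\<lambda>y n'. P y (n + n')))"
  by (cases m) (auto simp: spec_def split: timed.splits)

lemma spec_mono: "spec m P \<Longrightarrow> (\<And>x n. P x n \<Longrightarrow> Q x n) \<Longrightarrow> spec m Q"
  by (auto simp: spec_def)

lemma spec_new_array [simp]: "spec (new_array xs e) P \<longleftrightarrow> P (\<lambda>_. e) (length xs)"
  by (simp add: new_array_def)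

lemma spec_pq_put [simp]: "spec (pq_put i e Q) P \<longleftrightarrow> P (Q(i := Some e)) 1"
  by (simp add: pq_put_def)

lemma foreach_ret: "foreach xs (\<lambda>x s. ret (g x s)) s = Halts (fold g xs s) (length xs)"
  by (induction xs arbitrary: s) (simp_all add: ret_def tick_def)

lemma spec_foreach_ret [simp]:
  "spec (foreach xs (\<lambda>x s. ret (g x s)) s) P \<longleftrightarrow> P (fold g xs s) (length xs)"
  by (simp add: foreach_ret spec_def)

lemma spec_foreach:
  assumes "I [] s 0"
    and "\<And>ys x zs s n. xs = ys @ x # zs \<Longrightarrow> I ys s n \<Longrightarrow>
           spec (f x s) (\<lambda>s' n'. I (ys @ [x]) s' (n + 1 + n'))"
  shows "spec (foreach xs f s) (I xs)"
proof -
  have "spec (foreach zs f s) (\<lambda>s' n'. I xs s' (n + n'))" if "xs = ys @ zs" "I ys s n" for ys zs s n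
    using that
  proof (induction zs arbitrary: ys s n)
    case Nil
    then show ?case by simp
  next
    case (Cons z zs)
    have *: "spec (f z s) (\<lambda>s' n'. I (ys @ [z]) s' (n + 1 + n'))"
      using assms(2) Cons.prems by blast
    show ?case
      apply (simp)
      apply (rule spec_mono[OF *])
      using Cons.IH[of "ys @ [z]"] Cons.prems(1) by (fastforce simp: add.assoc)
  qed
  from this[of "[]" xs s 0] assms(1) show ?thesis by simp
qed

lemma while_timed_unfold:
  "while_timed b f s = (if b s then bind_timed (tick 1) (\<lambda>_. bind_timed (f s) (while_timed b f)) else ret s)"
proof -
  let ?b = "\<lambda>r. case r of Halts s' _ \<Rightarrow> b s' | Diverges \<Rightarrow> False"
  let ?c = "\<lambda>r. bind_timed r (\<lambda>s'. bind_timed (tick 1) (\<lambda>_. f s'))"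
  let ?add = "\<lambda>n r. bind_timed (tick n) (\<lambda>_. r)"
  have comm: "map_option (?add n) (while_option ?b ?c r) = while_option ?b ?c (?add n r)" for r n
    by (rule while_option_commute)
      (auto simp: tick_def ret_def split: timed.splits)
  show ?thesis
  proof (cases "b s")
    case False
    then show ?thesis by (simp add: while_timed_def ret_def while_option_unfold[of ?b])
  next
    case True
    show ?thesis
    proof (cases "f s")
      case (Halts s' n)
      have "while_option ?b ?c (ret s) = while_option ?b ?c (?add (Suc n) (ret s'))"
        by (subst while_option_unfold) (use True Halts in \<open>simp add: ret_def tick_def\<close>)
      also have "\<dots> = map_option (?add (Suc n)) (while_option ?b ?c (ret s'))"
        by (rule comm[symmetric])
      finally show ?thesis
        using True Halts
        by (auto simp: while_timed_def tick_def split: option.splits timed.splits)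
    next
      case Diverges
      have "while_option ?b ?c (ret s) = Some Diverges"
        by (subst while_option_unfold, subst while_option_unfold)
          (use True Diverges in \<open>simp add: ret_def tick_def\<close>)
      with Diverges True show ?thesis by (simp add: while_timed_def tick_def)
    qed
  qed
qed

lemma spec_while:
  fixes V :: "'s \<Rightarrow> nat"
  assumes "I s 0"
    and step: "\<And>s n. I s n \<Longrightarrow> b s \<Longrightarrow> spec (f s) (\<lambda>s' n'. I s' (n + 1 + n') \<and> V s' < V s)"
  shows "spec (while_timed b f s) (\<lambda>s n. I s n \<and> \<not> b s)"
proof -
  have "spec (while_timed b f s) (\<lambda>s n'. I s (n + n') \<and> \<not> b s)" if "I s n" for s n
    using that
  proof (induction "V s" arbitrary: s n rule: less_induct)
    case less
    show ?case
    proof (cases "b s")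
      case True
      show ?thesis
        apply (subst while_timed_unfold)
        apply (simp add: True)
        apply (rule spec_mono[OF step[OF less.prems True]])
        subgoal for s' n'
          using less.hyps[of s' "n + 1 + n'"] by (simp add: add.assoc)
        done
    qed (use less.prems in \<open>subst while_timed_unfold, simp\<close>)
  qed
  from this[of s 0] assms(1) show ?thesis by simp
qed

definition lex_le :: "real \<times> nat \<Rightarrow> real \<times> nat \<Rightarrow> bool" where
  "lex_le x y \<longleftrightarrow> fst x < fst y \<or> fst x = fst y \<and> snd x \<le> snd y"

lemma not_lex_less [simp]: "\<not> lex_less x y \<longleftrightarrow> lex_le y x"
  by (auto simp: lex_less_def lex_le_def)

lemma lex_less_imp_le: "lex_less x y \<Longrightarrow> lex_le x y"
  by (auto simp: lex_less_def lex_le_def)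

lemma lex_le_refl [simp]: "lex_le x x"
  by (simp add: lex_le_def)

lemma lex_le_trans: "lex_le x y \<Longrightarrow> lex_le y z \<Longrightarrow> lex_le x z"
  by (auto simp: lex_le_def)

lemma pq_min_in:
  assumes "finite (dom Q)" "\<not> pq_is_empty Q"
  shows "pq_min key Q \<in> dom Q \<and> (\<forall>j\<in>dom Q. lex_le (key (the (Q (pq_min key Q)))) (key (the (Q j))))"
proof -
  have "\<exists>i\<in>A. \<forall>j\<in>A. lex_le (key (the (Q i))) (key (the (Q j)))"
    if "finite A" "A \<noteq> {}" for A
    using that
  proof (induction rule: finite_ne_induct)
    case (insert x A)
    then obtain i where i: "i \<in> A" "\<forall>j\<in>A. lex_le (key (the (Q i))) (key (the (Q j)))" by blast
    show ?case
    proof (cases "lex_le (key (the (Q i))) (key (the (Q x)))")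
      case False
      then have "lex_le (key (the (Q x))) (key (the (Q i)))"
        by (auto simp: lex_le_def)
      with i show ?thesis by (blast intro: lex_le_trans lex_le_refl)
    qed (use i in auto)
  qed auto
  moreover have "dom Q \<noteq> {}"
    using assms(2) by (auto simp: pq_is_empty_def pq_empty_def)
  ultimately have "\<exists>i\<in>dom Q. \<forall>j\<in>dom Q. lex_le (key (the (Q i))) (key (the (Q j)))"
    using assms(1) by blast
  then have "\<exists>i. i \<in> dom Q \<and> (\<forall>j\<in>dom Q. \<not> lex_less (key (the (Q j))) (key (the (Q i))))"
    unfolding not_lex_less by blast
  from someI_ex[OF this] show ?thesis by (simp add: pq_min_def)
qed

lemma spec_pq_extract_min:
  assumes "finite (dom Q)" "\<not> pq_is_empty Q"
    and "\<And>i e. Q i = Some e \<Longrightarrow> (\<And>j e'. Q j = Some e' \<Longrightarrow> lex_le (key e) (key e')) \<Longrightarrow>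
      P (i, e, Q(i := None)) (1 + floorlog 2 (card (dom Q)))"
  shows "spec (pq_extract_min key Q) P"
proof -
  note min = pq_min_in[OF assms(1,2), of key]
  then obtain e where e: "Q (pq_min key Q) = Some e" by blast
  have "P (pq_min key Q, e, Q(pq_min key Q := None)) (1 + floorlog 2 (card (dom Q)))"
    using min e by (intro assms(3)) force+
  with e show ?thesis by (simp add: pq_extract_min_def Let_def)
qed

section \<open>Labels\<close>

definition lab_le :: "'a label \<Rightarrow> 'a label \<Rightarrow> bool" where
  "lab_le l l' \<longleftrightarrow> lex_le (label_key l) (label_key l')"

definition lab_dom :: "'a label \<Rightarrow> 'a label \<Rightarrow> bool" where
  "lab_dom l l' \<longleftrightarrow> fst l \<le> fst l' \<and> fst (snd l) \<le> fst (snd l')"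

lemma lab_le_refl [simp]: "lab_le l l"
  by (simp add: lab_le_def)

lemma lab_le_trans: "lab_le l l' \<Longrightarrow> lab_le l' l'' \<Longrightarrow> lab_le l l''"
  unfolding lab_le_def by (rule lex_le_trans)

lemma lab_dom_imp_le: "lab_dom l l' \<Longrightarrow> lab_le l l'"
  by (auto simp: lab_le_def lab_dom_def lex_le_def label_key_def)

lemma lab_dom_trans: "lab_dom l l' \<Longrightarrow> lab_dom l' l'' \<Longrightarrow> lab_dom l l''"
  by (auto simp: lab_dom_def)

lemma lab_leD: "lab_le l l' \<Longrightarrow> fst l \<le> fst l'"
  by (auto simp: lab_le_def lex_le_def label_key_def)

lemma extend_label_simps [simp]:
  "fst (extend_label c on a l) = fst l + c a"
  "fst (snd (extend_label c on a l)) = fst (snd l) + (if on a then 1 else 0)"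
  "snd (snd (extend_label c on a l)) = a # snd (snd l)"
  by (auto simp: extend_label_def split: prod.splits)

lemma extend_label_mono: "lab_le l l' \<Longrightarrow> lab_le (extend_label c on a l) (extend_label c on a l')"
  by (auto simp: lab_le_def lex_le_def label_key_def)

lemma dominated_append [simp]: "dominated (L @ [l]) l' \<longleftrightarrow> fst (snd l) \<le> fst (snd l')"
  by (simp add: dominated_def)

lemma dominated_Nil [simp]: "\<not> dominated [] l"
  by (simp add: dominated_def)

definition efficient_list :: "'a label list \<Rightarrow> bool" where
  "efficient_list = sorted_wrt (\<lambda>l l'. lab_le l l' \<and> fst (snd l') < fst (snd l))"

lemma efficient_list_nth:
  "efficient_list L \<Longrightarrow> i \<le> j \<Longrightarrow> j < length L \<Longrightarrow> lab_le (L ! i) (L ! j)"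
  unfolding efficient_list_def by (cases "i = j") (auto simp: sorted_wrt_iff_nth_less)

lemma efficient_list_last:
  "efficient_list L \<Longrightarrow> l \<in> set L \<Longrightarrow> fst (snd (last L)) \<le> fst (snd l)"
  by (induction L rule: rev_induct) (auto simp: efficient_list_def sorted_wrt_append)

lemma efficient_list_append:
  assumes "efficient_list L" "\<not> dominated L l" "\<And>l'. l' \<in> set L \<Longrightarrow> lab_le l' l"
  shows "efficient_list (L @ [l])"
  using assms efficient_list_last[OF assms(1)]
  by (fastforce simp: efficient_list_def sorted_wrt_append dominated_def)

lemma efficient_list_length:
  assumes "efficient_list L" "\<And>l. l \<in> set L \<Longrightarrow> fst (snd l) < n"
  shows "length L \<le> n"
proof -
  let ?f = "\<lambda>l::'a label. fst (snd l)"
  have "sorted_wrt (>) (map ?f L)"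
    using assms(1) by (auto simp: efficient_list_def sorted_wrt_map intro: sorted_wrt_mono_rel[rotated])
  then have "distinct (map ?f L)"
    by (induction L) auto
  then have "length L = card (?f ` set L)"
    by (metis distinct_card length_map set_map)
  also have "\<dots> \<le> card {..<n}"
    using assms(2) by (intro card_mono) auto
  finally show ?thesis by simp
qed

lemma sum_fun_upd:
  fixes f :: "'a \<Rightarrow> nat"
  assumes "finite A" "a \<in> A"
  shows "sum (f(a := x)) A + f a = sum f A + x"
  using assms by (simp add: sum.remove)

section \<open>The biobjective search\<close>

locale search = fin_digraph G for G :: "('v, 'a) pre_digraph" +
  fixes c :: "'a \<Rightarrow> real" and H :: "('v, 'a) adj_graph" and on :: "'a \<Rightarrow> bool" and s :: 'v
  assumes arcs_H: "set (aa H) \<subseteq> arcs G"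
    and out_H: "set (aout H v) = {a \<in> set (aa H). tail G a = v}" "distinct (aout H v)"
    and in_H: "set (ain H v) = {a \<in> set (aa H). head G a = v}" "distinct (ain H v)"
    and length_H: "length (av H) \<le> card (verts G)" "length (aa H) \<le> card (arcs G)"
    and source: "s \<in> verts G"
    and cost_nonneg: "a \<in> arcs G \<Longrightarrow> 0 \<le> c a"
begin

abbreviation "E \<equiv> set (aa H)"
abbreviation "ext \<equiv> extend_label c on"

definition marked :: "'a list \<Rightarrow> nat" where
  "marked p = length (filter on p)"

lemma marked_simps [simp]:
  "marked [] = 0"
  "marked (p @ q) = marked p + marked q"
  "marked (a # p) = (if on a then 1 else 0) + marked p"
  "marked (rev p) = marked p"
  by (auto simp: marked_def rev_filter[symmetric])

definition path_label :: "'v \<Rightarrow> 'a label \<Rightarrow> bool" where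
  "path_label v l \<longleftrightarrow> (let p = rev (snd (snd l)) in
     awalk s p v \<and> set p \<subseteq> E \<and> fst l = awalk_cost c p \<and> fst (snd l) = marked p)"

abbreviation "label_verts l \<equiv> awalk_verts s (rev (snd (snd l)))"

lemma path_label_ext:
  assumes "path_label v l" "a \<in> E" "tail G a = v"
  shows "path_label (head G a) (ext a l)"
  using assms arcs_H
  by (auto simp: path_label_def Let_def awalk_append_iff awalk_simps)

lemma cost_walk_nonneg: "set p \<subseteq> arcs G \<Longrightarrow> 0 \<le> awalk_cost c p"
  by (induction p) (auto intro: cost_nonneg add_nonneg_nonneg)

lemma ext_dom: "a \<in> E \<Longrightarrow> lab_dom l (ext a l)"
  using cost_nonneg arcs_H by (auto simp: lab_dom_def)

lemma ext_ge: "a \<in> E \<Longrightarrow> lab_le l (ext a l)"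
  by (rule lab_dom_imp_le[OF ext_dom])

lemma label_verts_ext:
  assumes "path_label (tail G a) l"
  shows "label_verts (ext a l) = label_verts l @ [head G a]"
proof -
  have *: "awalk_verts u (p @ [a]) = awalk_verts u p @ [head G a]" if "cas u p (tail G a)" for u p
    using that by (induction p arbitrary: u) auto
  have "cas s (rev (snd (snd l))) (tail G a)"
    using assms by (simp add: path_label_def Let_def awalk_def)
  from *[OF this] show ?thesis by simp
qed

lemma next_candidate_spec:
  assumes sorted: "\<forall>v. efficient_list (perm v)"
    and nx: "\<forall>a\<in>E. nx a \<le> length (perm (tail G a)) \<and>
      (\<forall>i<nx a. dominated (perm (head G a)) (ext a (perm (tail G a) ! i)))"
  shows "spec (next_candidate G c H on perm v nx) (\<lambda>(best, nx') T.
    T + sum nx E \<le> length (ain H v) + sum nx' E \<and>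
    (\<forall>a\<in>E. nx' a \<le> length (perm (tail G a)) \<and>
      (\<forall>i<nx' a. dominated (perm (head G a)) (ext a (perm (tail G a) ! i)))) \<and>
    (\<forall>b. best = Some b \<longrightarrow> \<not> dominated (perm v) b \<and>
      (\<exists>a\<in>E. head G a = v \<and> (\<exists>l\<in>set (perm (tail G a)). b = ext a l))) \<and>
    (\<forall>a\<in>E. head G a = v \<longrightarrow> (\<forall>l\<in>set (perm (tail G a)).
      dominated (perm v) (ext a l) \<or> (\<exists>b. best = Some b \<and> lab_le b (ext a l)))))"
proof -
  let ?I = "\<lambda>ys (best, nx') T.
    T + sum nx E \<le> length ys + sum nx' E \<and>
    (\<forall>a\<in>E. nx' a \<le> length (perm (tail G a)) \<and>
      (\<forall>i<nx' a. dominated (perm (head G a)) (ext a (perm (tail G a) ! i)))) \<and>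
    (\<forall>b. best = Some b \<longrightarrow> \<not> dominated (perm v) b \<and>
      (\<exists>a\<in>E. head G a = v \<and> (\<exists>l\<in>set (perm (tail G a)). b = ext a l))) \<and>
    (\<forall>a\<in>set ys. \<forall>l\<in>set (perm (tail G a)).
      dominated (perm v) (ext a l) \<or> (\<exists>b. best = Some b \<and> lab_le b (ext a l)))"
  have "spec (next_candidate G c H on perm v nx) (?I (ain H v))"
    unfolding next_candidate_def
  proof (rule spec_foreach, goal_cases)
    case 1
    then show ?case using nx by auto
  next
    case (2 ys a zs st T)
    obtain best nx' where st: "st = (best, nx')" by force
    let ?L = "perm (tail G a)"
    have a: "a \<in> E" "head G a = v" using 2(1) in_H(1)[of v] by auto
    have I: "?I ys (best, nx') T" using 2(2) st by simp
    let ?J = "\<lambda>i n. nx' a \<le> i \<and> n + nx' a \<le> i \<and> i \<le> length ?L \<and>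
      (\<forall>j<i. dominated (perm v) (ext a (?L ! j)))"
    let ?b = "\<lambda>i. i < length ?L \<and> dominated (perm v) (ext a (?L ! i))"
    have "spec (while_timed ?b (\<lambda>i. ret (i + 1)) (nx' a)) (\<lambda>i n. ?J i n \<and> \<not> ?b i)"
      by (rule spec_while[where V = "\<lambda>i. length ?L - i"])
        (use I a in \<open>auto simp: less_Suc_eq\<close>)
    then show ?case
      unfolding st prod.case Let_def spec_bind spec_ret
    proof (rule spec_mono, goal_cases)
      case (1 i n)
      let ?cond = "i < length ?L \<and>
        (case best of None \<Rightarrow> True | Some b \<Rightarrow> lex_less (label_key (ext a (?L ! i))) (label_key b))"
      define best' where "best' = (if ?cond then Some (ext a (?L ! i)) else best)"
      have old: "\<exists>b'. best' = Some b' \<and> lab_le b' b" if "best = Some b" for b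
        using that by (auto simp: best'_def lab_le_def intro: lex_less_imp_le)
      have new: "\<exists>b'. best' = Some b' \<and> lab_le b' (ext a (?L ! i))" if "i < length ?L"
        using that by (cases best) (auto simp: best'_def lab_le_def)
      have time: "T + 1 + n + sum nx E \<le> length (ys @ [a]) + sum (nx'(a := i)) E"
        using I 1 sum_fun_upd[of E a nx' i] a by (simp del: fun_upd_apply)
      have best: "\<forall>b. best' = Some b \<longrightarrow> \<not> dominated (perm v) b \<and>
        (\<exists>a\<in>E. head G a = v \<and> (\<exists>l\<in>set (perm (tail G a)). b = ext a l))"
      proof (intro allI impI)
        fix b assume b: "best' = Some b"
        show "\<not> dominated (perm v) b \<and>
          (\<exists>a\<in>E. head G a = v \<and> (\<exists>l\<in>set (perm (tail G a)). b = ext a l))"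
        proof (cases ?cond)
          case True
          then have "b = ext a (?L ! i)" "?L ! i \<in> set ?L" "\<not> dominated (perm v) (ext a (?L ! i))"
            using b 1 by (auto simp: best'_def)
          with a show ?thesis by blast
        next
          case False
          then have "best = Some b" using b unfolding best'_def by (simp only: if_False)
          with I show ?thesis by blast
        qed
      qed
      have cov: "dominated (perm v) (ext e l) \<or> (\<exists>b. best' = Some b \<and> lab_le b (ext e l))"
        if e: "e \<in> set (ys @ [a])" "l \<in> set (perm (tail G e))" for e l
      proof (cases "e \<in> set ys")
        case True
        then have "dominated (perm v) (ext e l) \<or> (\<exists>b. best = Some b \<and> lab_le b (ext e l))"
          using I that(2) by blast
        then show ?thesis
        proof
          assume "\<exists>b. best = Some b \<and> lab_le b (ext e l)"
          then obtain b where "best = Some b" "lab_le b (ext e l)" by blast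
          with old[of b] show ?thesis by (blast intro: lab_le_trans)
        qed simp
      next
        case False
        then have "e = a" using that by simp
        then obtain j where j: "j < length ?L" "l = ?L ! j"
          using e(2) unfolding \<open>e = a\<close> in_set_conv_nth by blast
        show ?thesis
        proof (cases "j < i")
          case True
          then show ?thesis using 1 j \<open>e = a\<close> by auto
        next
          case False
          then have "lab_le (ext a (?L ! i)) (ext a (?L ! j))"
            using j sorted by (intro extend_label_mono efficient_list_nth) auto
          then show ?thesis using new j False \<open>e = a\<close> by (meson lab_le_trans le_less_trans not_le)
        qed
      qed
      show ?case
        using time best cov I 1 a unfolding best'_def[symmetric] prod.case by (simp add: add.assoc)
    qed
  qed
  then show ?thesis
    by (rule spec_mono) (use in_H(1) in auto)
qed

lemma propagate_spec:
  shows "spec (propagate G c H on perm v l Q) (\<lambda>Q' T.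
    T \<le> 2 * length (aout H v) \<and>
    (\<forall>w b. Q' w = Some b \<longrightarrow> Q w = Some b \<or>
      (\<exists>a\<in>E. tail G a = v \<and> head G a = w \<and> b = ext a l \<and> \<not> dominated (perm w) b)) \<and>
    (\<forall>w b. Q w = Some b \<longrightarrow> (\<exists>b'. Q' w = Some b' \<and> lab_le b' b)) \<and>
    (\<forall>a\<in>E. tail G a = v \<longrightarrow> dominated (perm (head G a)) (ext a l) \<or>
      (\<exists>b'. Q' (head G a) = Some b' \<and> lab_le b' (ext a l))))"
proof -
  let ?I = "\<lambda>ys Q' T.
    T \<le> 2 * length ys \<and>
    (\<forall>w b. Q' w = Some b \<longrightarrow> Q w = Some b \<or>
      (\<exists>a\<in>E. tail G a = v \<and> head G a = w \<and> b = ext a l \<and> \<not> dominated (perm w) b)) \<and>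
    (\<forall>w b. Q w = Some b \<longrightarrow> (\<exists>b'. Q' w = Some b' \<and> lab_le b' b)) \<and>
    (\<forall>a\<in>set ys. dominated (perm (head G a)) (ext a l) \<or>
      (\<exists>b'. Q' (head G a) = Some b' \<and> lab_le b' (ext a l)))"
  have "spec (propagate G c H on perm v l Q) (?I (aout H v))"
    unfolding propagate_def
  proof (rule spec_foreach, goal_cases)
    case 1
    then show ?case by auto
  next
    case (2 ys a zs Q' T)
    have a: "a \<in> E" "tail G a = v" using 2(1) out_H(1)[of v] by auto
    let ?w = "head G a"
    let ?c = "\<not> dominated (perm ?w) (ext a l) \<and>
      (case Q' ?w of None \<Rightarrow> True | Some b \<Rightarrow> lex_less (label_key (ext a l)) (label_key b))"
    have I: "?I ys Q' T" by fact
    show ?case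
    proof (cases ?c)
      case True
      let ?Q = "Q'(?w := Some (ext a l))"
      have mono: "\<exists>b'. ?Q w = Some b' \<and> lab_le b' b" if "Q' w = Some b" for w b
        using that True by (auto simp: lab_le_def intro: lex_less_imp_le)
      have "?I (ys @ [a]) ?Q (T + 1 + 1)"
      proof (intro conjI allI ballI impI)
        fix w b assume b: "?Q w = Some b"
        show "Q w = Some b \<or>
          (\<exists>a\<in>E. tail G a = v \<and> head G a = w \<and> b = ext a l \<and> \<not> dominated (perm w) b)"
        proof (cases "w = ?w")
          case True
          then have "b = ext a l" using b by simp
          with True a \<open>?c\<close> show ?thesis by blast
        next
          case False
          then have "Q' w = Some b" using b by simp
          with I show ?thesis by blast
        qed
      next
        show "T + 1 + 1 \<le> 2 * length (ys @ [a])" using I by simp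
      next
        fix w b assume "Q w = Some b"
        then show "\<exists>b'. ?Q w = Some b' \<and> lab_le b' b"
          using I mono by (meson lab_le_trans)
      next
        fix e assume "e \<in> set (ys @ [a])"
        then show "dominated (perm (head G e)) (ext e l) \<or>
          (\<exists>b'. ?Q (head G e) = Some b' \<and> lab_le b' (ext e l))"
        proof (cases "e = a")
          case False
          then have "e \<in> set ys" using \<open>e \<in> set (ys @ [a])\<close> by simp
          with I mono show ?thesis by (meson lab_le_trans)
        qed simp
      qed
      with True show ?thesis by (simp add: Let_def)
    next
      case False
      then have "dominated (perm ?w) (ext a l) \<or> (\<exists>b'. Q' ?w = Some b' \<and> lab_le b' (ext a l))"
        by (auto simp: lab_le_def split: option.splits)
      then have "?I (ys @ [a]) Q' (T + 1 + 0)"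
        using I by auto
      then show ?thesis unfolding Let_def if_not_P[OF False] by simp
    qed
  qed
  then show ?thesis
    by (rule spec_mono) (use out_H(1) in auto)
qed

text \<open>
  Labels are dominated at all vertices of their own path.  Hence an undominated extension leads to
  a new vertex, so labels represent simple paths.  The clauses with \<^const>\<open>lab_dom\<close> cannot use
  \<^const>\<open>dominated\<close>, which compares second costs only: later labels at the head of an arc may
  have larger first costs.
\<close>

definition search_inv :: "('v \<Rightarrow> 'a label list) \<Rightarrow> ('a \<Rightarrow> nat) \<Rightarrow> ('v, 'a label) pq \<Rightarrow> bool" where
  "search_inv perm nx Q \<longleftrightarrow>
    (\<forall>v. efficient_list (perm v)) \<and>
    (\<forall>v. \<forall>l\<in>set (perm v). path_label v l \<and> distinct (label_verts l) \<and>
      (\<forall>u\<in>set (label_verts l). dominated (perm u) l)) \<and>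
    (\<forall>v b. Q v = Some b \<longrightarrow> path_label v b \<and> distinct (label_verts b) \<and>
      (\<forall>u\<in>set (label_verts b). u \<noteq> v \<longrightarrow> dominated (perm u) b) \<and> \<not> dominated (perm v) b) \<and>
    (\<forall>v w b. Q w = Some b \<longrightarrow> (\<forall>l\<in>set (perm v). lab_le l b)) \<and>
    (\<forall>a\<in>E. \<forall>l\<in>set (perm (tail G a)).
      (\<exists>l'\<in>set (perm (head G a)). lab_dom l' (ext a l)) \<or>
      (\<exists>b. Q (head G a) = Some b \<and> lab_le b (ext a l))) \<and>
    ((\<exists>l\<in>set (perm s). lab_dom l (0, 0, [])) \<or> (\<exists>b. Q s = Some b \<and> lab_le b (0, 0, []))) \<and>
    (\<forall>a\<in>E. nx a \<le> length (perm (tail G a)) \<and>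
      (\<forall>i<nx a. dominated (perm (head G a)) (ext a (perm (tail G a) ! i))))"

lemma search_invD:
  assumes "search_inv perm nx Q"
  shows "efficient_list (perm v)"
    and "l \<in> set (perm v) \<Longrightarrow> path_label v l"
    and "l \<in> set (perm v) \<Longrightarrow> distinct (label_verts l)"
    and "l \<in> set (perm v) \<Longrightarrow> u \<in> set (label_verts l) \<Longrightarrow> dominated (perm u) l"
    and "Q v = Some b \<Longrightarrow> path_label v b"
    and "Q v = Some b \<Longrightarrow> distinct (label_verts b)"
    and "Q v = Some b \<Longrightarrow> u \<in> set (label_verts b) \<Longrightarrow> u \<noteq> v \<Longrightarrow> dominated (perm u) b"
    and "Q v = Some b \<Longrightarrow> \<not> dominated (perm v) b"
    and "Q w = Some b \<Longrightarrow> l \<in> set (perm v) \<Longrightarrow> lab_le l b"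
    and "a \<in> E \<Longrightarrow> l \<in> set (perm (tail G a)) \<Longrightarrow>
      (\<exists>l'\<in>set (perm (head G a)). lab_dom l' (ext a l)) \<or>
      (\<exists>b. Q (head G a) = Some b \<and> lab_le b (ext a l))"
    and "(\<exists>l\<in>set (perm s). lab_dom l (0, 0, [])) \<or> (\<exists>b. Q s = Some b \<and> lab_le b (0, 0, []))"
    and "a \<in> E \<Longrightarrow> nx a \<le> length (perm (tail G a))"
    and "a \<in> E \<Longrightarrow> i < nx a \<Longrightarrow> dominated (perm (head G a)) (ext a (perm (tail G a) ! i))"
  using assms unfolding search_inv_def by blast+

lemma search_inv_init: "search_inv (\<lambda>_. []) (\<lambda>_. 0) (pq_empty(s := Some (0, 0, [])))"
  using source
  by (auto simp: search_inv_def pq_empty_def efficient_list_def path_label_def awalk_simps)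

lemma path_label_cost_nonneg: "path_label v l \<Longrightarrow> 0 \<le> fst l"
  using arcs_H by (auto simp: path_label_def Let_def intro!: cost_walk_nonneg)

lemma search_inv_dom_queue:
  assumes "search_inv perm nx Q"
  shows "dom Q \<subseteq> verts G"
  using search_invD(5)[OF assms] by (auto simp: path_label_def Let_def dest!: awalk_last_in_verts)

lemma search_inv_walk:
  assumes inv: "search_inv perm nx Q" and "awalk s w v" "set w \<subseteq> E"
  shows "(\<exists>l\<in>set (perm v). lab_dom l (awalk_cost c w, marked w, [])) \<or>
    (\<exists>u b. Q u = Some b \<and> lab_le b (awalk_cost c w, marked w, []))"
  using assms(2,3)
proof (induction w arbitrary: v rule: rev_induct)
  case Nil
  then show ?case using search_invD(11)[OF inv] by (auto simp: awalk_simps)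
next
  case (snoc a w)
  have a: "a \<in> E" "head G a = v" and w: "awalk s w (tail G a)" "set w \<subseteq> E"
    using snoc.prems by (auto simp: awalk_append_iff awalk_simps)
  let ?x = "(awalk_cost c w, marked w, []) :: 'a label"
  let ?y = "(awalk_cost c (w @ [a]), marked (w @ [a]), []) :: 'a label"
  have ext: "fst (ext a ?x) = fst ?y" "fst (snd (ext a ?x)) = fst (snd ?y)" by auto
  then have le: "lab_le b ?y" if "lab_le b (ext a ?x)" for b
    using that unfolding lab_le_def label_key_def by simp
  from snoc.IH[OF w] show ?case
  proof
    assume "\<exists>l\<in>set (perm (tail G a)). lab_dom l ?x"
    then obtain l where l: "l \<in> set (perm (tail G a))" "lab_dom l ?x" by blast
    from search_invD(10)[OF inv a(1) l(1)] show ?case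
    proof
      assume "\<exists>l'\<in>set (perm (head G a)). lab_dom l' (ext a l)"
      then obtain l' where "l' \<in> set (perm v)" "lab_dom l' (ext a l)" using a(2) by blast
      moreover have "lab_dom (ext a l) ?y"
        using l(2) by (auto simp: lab_dom_def)
      ultimately show ?case by (blast intro: lab_dom_trans)
    next
      assume "\<exists>b. Q (head G a) = Some b \<and> lab_le b (ext a l)"
      moreover have "lab_le (ext a l) (ext a ?x)"
        using l(2) by (intro extend_label_mono lab_dom_imp_le)
      ultimately show ?case by (blast intro: lab_le_trans le)
    qed
  next
    assume "\<exists>u b. Q u = Some b \<and> lab_le b ?x"
    then show ?case using ext_ge[OF a(1)] by (blast intro: lab_le_trans le)
  qed
qed

lemma search_inv_extract:
  assumes inv: "search_inv perm nx Q"
    and l: "Q v = Some l" and min: "\<forall>w b. Q w = Some b \<longrightarrow> lab_le l b"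
  defines "perm' \<equiv> perm(v := perm v @ [l])"
  shows "efficient_list (perm' w)"
    and "dominated (perm w) l' \<Longrightarrow> dominated (perm' w) l'"
    and "a \<in> E \<Longrightarrow> nx a \<le> length (perm' (tail G a))"
    and "a \<in> E \<Longrightarrow> i < nx a \<Longrightarrow> dominated (perm' (head G a)) (ext a (perm' (tail G a) ! i))"
    and "l' \<in> set (perm' w) \<Longrightarrow> lab_le l' l"
    and "l' \<in> set (perm' w) \<Longrightarrow> path_label w l'"
    and "l' \<in> set (perm' w) \<Longrightarrow> distinct (label_verts l')"
    and "l' \<in> set (perm' w) \<Longrightarrow> u \<in> set (label_verts l') \<Longrightarrow> dominated (perm' u) l'"
proof -
  note nd = search_invD(8)[OF inv l]
  have le: "lab_le l' l" if "l' \<in> set (perm w)" for l' w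
    using search_invD(9)[OF inv l that] .
  show "efficient_list (perm' w)"
    using search_invD(1)[OF inv] nd le by (auto simp: perm'_def intro!: efficient_list_append)
  show mono: "dominated (perm w) l' \<Longrightarrow> dominated (perm' w) l'" for w l'
    using nd by (auto simp: perm'_def dominated_def)
  show "a \<in> E \<Longrightarrow> nx a \<le> length (perm' (tail G a))"
    using search_invD(12)[OF inv, of a] by (auto simp: perm'_def)
  show "dominated (perm' (head G a)) (ext a (perm' (tail G a) ! i))" if "a \<in> E" "i < nx a"
  proof -
    have "perm' (tail G a) ! i = perm (tail G a) ! i"
      using search_invD(12)[OF inv that(1)] that(2) by (auto simp: perm'_def nth_append)
    then show ?thesis using mono search_invD(13)[OF inv that] by simp
  qed
  show "l' \<in> set (perm' w) \<Longrightarrow> lab_le l' l"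
    using le[of l' w] by (cases "w = v") (auto simp: perm'_def)
  show "l' \<in> set (perm' w) \<Longrightarrow> path_label w l'"
    using search_invD(2)[OF inv, of l' w] search_invD(5)[OF inv l] by (auto simp: perm'_def split: if_splits)
  show "l' \<in> set (perm' w) \<Longrightarrow> distinct (label_verts l')"
    using search_invD(3)[OF inv, of l' w] search_invD(6)[OF inv l] by (auto simp: perm'_def split: if_splits)
  show "dominated (perm' u) l'" if "l' \<in> set (perm' w)" "u \<in> set (label_verts l')"
  proof (cases "l' \<in> set (perm w)")
    case True
    with search_invD(4)[OF inv] that mono show ?thesis by blast
  next
    case False
    then have "l' = l" using that(1) by (auto simp: perm'_def split: if_splits)
    then show ?thesis
      using search_invD(7)[OF inv l, of u] that mono by (cases "u = v") (auto simp: perm'_def)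
  qed
qed

lemma search_inv_step:
  assumes inv: "search_inv perm nx Q"
    and l: "Q v = Some l" and min: "\<forall>w b. Q w = Some b \<longrightarrow> lab_le l b"
  defines "perm' \<equiv> perm(v := perm v @ [l])"
  assumes nx': "\<forall>a\<in>E. nx' a \<le> length (perm' (tail G a)) \<and>
      (\<forall>i<nx' a. dominated (perm' (head G a)) (ext a (perm' (tail G a) ! i)))"
    and best: "\<forall>b. best = Some b \<longrightarrow> \<not> dominated (perm' v) b \<and>
      (\<exists>a\<in>E. head G a = v \<and> (\<exists>l\<in>set (perm' (tail G a)). b = ext a l))"
      "\<forall>a\<in>E. head G a = v \<longrightarrow> (\<forall>l\<in>set (perm' (tail G a)).
      dominated (perm' v) (ext a l) \<or> (\<exists>b. best = Some b \<and> lab_le b (ext a l)))"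
  defines "Q1 \<equiv> Q(v := best)"
  assumes Q': "\<forall>w b. Q' w = Some b \<longrightarrow> Q1 w = Some b \<or>
      (\<exists>a\<in>E. tail G a = v \<and> head G a = w \<and> b = ext a l \<and> \<not> dominated (perm' w) b)"
      "\<forall>w b. Q1 w = Some b \<longrightarrow> (\<exists>b'. Q' w = Some b' \<and> lab_le b' b)"
      "\<forall>a\<in>E. tail G a = v \<longrightarrow> dominated (perm' (head G a)) (ext a l) \<or>
      (\<exists>b'. Q' (head G a) = Some b' \<and> lab_le b' (ext a l))"
  shows "search_inv perm' nx' Q'"
proof -
  note ex = search_inv_extract[OF inv l min, folded perm'_def]
  have sub: "set (perm w) \<subseteq> set (perm' w)" for w by (auto simp: perm'_def)
  have l_in: "l \<in> set (perm' v)" by (simp add: perm'_def)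
  have cases': "l' \<in> set (perm w) \<or> w = v \<and> l' = l" if "l' \<in> set (perm' w)" for w l'
    using that by (auto simp: perm'_def split: if_splits)
  have dom_imp: "dominated (perm' w) x" if "l' \<in> set (perm' w)" "lab_dom l' x" for w l' x
    using efficient_list_last[OF ex(1) that(1)] that by (auto simp: dominated_def lab_dom_def)
  have old: "(\<exists>l''\<in>set (perm' (head G a)). lab_dom l'' (ext a l')) \<or>
      (head G a = v \<and> lab_le l (ext a l')) \<or>
      (head G a \<noteq> v \<and> (\<exists>b. Q' (head G a) = Some b \<and> lab_le b (ext a l')))"
    if "a \<in> E" "l' \<in> set (perm (tail G a))" for a l'
    using search_invD(10)[OF inv that]
  proof
    assume "\<exists>b. Q (head G a) = Some b \<and> lab_le b (ext a l')"
    then obtain b where b: "Q (head G a) = Some b" "lab_le b (ext a l')" by blast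
    show ?thesis
    proof (cases "head G a = v")
      case False
      then have "Q1 (head G a) = Some b" using b by (simp add: Q1_def)
      with False b(2) Q'(2) show ?thesis by (blast intro: lab_le_trans)
    qed (use b l in auto)
  qed (use sub in blast)
  have le_new: "lab_le l (ext a l')"
    if "a \<in> E" "l' \<in> set (perm' (tail G a))" "\<not> dominated (perm' (head G a)) (ext a l')"
      "head G a = v" for a l'
    using cases'[OF that(2)]
  proof
    assume "l' \<in> set (perm (tail G a))"
    with old[OF that(1)] dom_imp that show ?thesis by blast
  qed (use ext_ge[OF that(1)] in simp)
  have fresh: "path_label (head G a) (ext a l') \<and> distinct (label_verts (ext a l')) \<and>
      (\<forall>u\<in>set (label_verts (ext a l')). u \<noteq> head G a \<longrightarrow> dominated (perm' u) (ext a l'))"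
    if a: "a \<in> E" "l' \<in> set (perm' (tail G a))" "\<not> dominated (perm' (head G a)) (ext a l')" for a l'
  proof -
    have on_path: "dominated (perm' u) (ext a l')" if "u \<in> set (label_verts l')" for u
      using ex(8)[OF a(2) that] by (auto simp: dominated_def)
    note lab = ex(6)[OF a(2)]
    show ?thesis
      using path_label_ext[OF lab a(1) refl] label_verts_ext[OF lab] ex(7)[OF a(2)] on_path a(3)
      by auto
  qed
  have Q'_entry: "path_label w b \<and> distinct (label_verts b) \<and>
      (\<forall>u\<in>set (label_verts b). u \<noteq> w \<longrightarrow> dominated (perm' u) b) \<and> \<not> dominated (perm' w) b \<and>
      lab_le l b" if Qw: "Q' w = Some b" for w b
  proof -
    consider "w \<noteq> v" "Q w = Some b" | "w = v" "best = Some b" |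
      a where "a \<in> E" "tail G a = v" "head G a = w" "b = ext a l" "\<not> dominated (perm' w) b"
      using Q'(1) Qw unfolding Q1_def by (metis fun_upd_apply)
    then show ?thesis
    proof cases
      case 1
      with search_invD(5-8)[OF inv 1(2)] ex(2) min show ?thesis by (auto simp: perm'_def)
    next
      case 2
      then obtain a l' where "a \<in> E" "head G a = v" "l' \<in> set (perm' (tail G a))" "b = ext a l'"
        "\<not> dominated (perm' v) b"
        using best(1) by blast
      with fresh[of a l'] le_new[of a l'] 2 show ?thesis by blast
    next
      case 3
      with fresh[of a l] l_in ext_ge[of a l] show ?thesis by blast
    qed
  qed
  have cover: "(\<exists>l''\<in>set (perm' (head G a)). lab_dom l'' (ext a l')) \<or>
      (\<exists>b. Q' (head G a) = Some b \<and> lab_le b (ext a l'))"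
    if a: "a \<in> E" "l' \<in> set (perm' (tail G a))" for a l'
  proof -
    have dom: "\<exists>l''\<in>set (perm' (head G a)). lab_dom l'' (ext a l')"
      if "dominated (perm' (head G a)) (ext a l')" "lab_le l (ext a l')"
    proof -
      let ?L = "perm' (head G a)"
      have "last ?L \<in> set ?L" using that(1) by (auto simp: dominated_def)
      then have "lab_le (last ?L) (ext a l')" using ex(5) that(2) by (blast intro: lab_le_trans)
      then have "lab_dom (last ?L) (ext a l')"
        using that(1) by (auto simp: lab_dom_def dominated_def dest: lab_leD)
      with \<open>last ?L \<in> set ?L\<close> show ?thesis by blast
    qed
    show ?thesis
    proof (cases "head G a = v")
      case True
      have le: "(\<exists>l''\<in>set (perm' (head G a)). lab_dom l'' (ext a l')) \<or> lab_le l (ext a l')"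
        using cases'[OF a(2)] old[OF a(1), of l'] ext_ge[OF a(1), of l] True by blast
      from best(2) a True have "dominated (perm' (head G a)) (ext a l') \<or>
        (\<exists>b. Q1 (head G a) = Some b \<and> lab_le b (ext a l'))"
        by (simp add: Q1_def)
      with le dom Q'(2) show ?thesis by (blast intro: lab_le_trans)
    next
      case False
      from cases'[OF a(2)] show ?thesis
      proof
        assume "l' \<in> set (perm (tail G a))"
        with old[OF a(1)] False show ?thesis by blast
      next
        assume "tail G a = v \<and> l' = l"
        with Q'(3) a(1) dom ext_ge[OF a(1), of l] show ?thesis by blast
      qed
    qed
  qed
  have start: "(\<exists>l\<in>set (perm' s). lab_dom l (0, 0, [])) \<or> (\<exists>b. Q' s = Some b \<and> lab_le b (0, 0, []))"
  proof (cases "s = v")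
    case True
    have "lab_dom l (0, 0, [])" if "lab_le l (0, 0, [])"
      using that path_label_cost_nonneg[OF search_invD(5)[OF inv l]]
      by (auto simp: lab_dom_def lab_le_def lex_le_def label_key_def)
    with search_invD(11)[OF inv] l l_in sub True show ?thesis by auto
  next
    case False
    from search_invD(11)[OF inv] show ?thesis
    proof
      assume "\<exists>b. Q s = Some b \<and> lab_le b (0, 0, [])"
      then obtain b where "Q1 s = Some b" "lab_le b (0, 0, [])"
        using False unfolding Q1_def by auto
      with Q'(2) show ?thesis by (blast intro: lab_le_trans)
    qed (use sub in blast)
  qed
  have "lab_le l' b" if "Q' w = Some b" "l' \<in> set (perm' u)" for w b l' u
    using ex(5)[OF that(2)] Q'_entry[OF that(1)] by (blast intro: lab_le_trans)
  then show ?thesis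
    unfolding search_inv_def using ex(1,6-8) Q'_entry cover start nx'
    by (intro conjI allI ballI impI) blast+
qed

end

lemma sum_length_append:
  assumes "finite V" "v \<in> V"
  shows "(\<Sum>u\<in>V. length ((perm(v := perm v @ [l])) u) * f u) = (\<Sum>u\<in>V. length (perm u) * f u) + f v"
  using assms by (simp add: sum.remove)

context fin_digraph begin

abbreviation "n \<equiv> card (verts G)"
abbreviation "m \<equiv> card (arcs G)"

definition max_potential :: nat where
  "max_potential = n * (n * (floorlog 2 n + 3) + 3 * m) + m * n"

definition time_bda :: nat where
  "time_bda = max_potential + floorlog 2 n + 3 * n + m + 3"

end

context search begin

definition weight :: "'v \<Rightarrow> nat" where
  "weight v = floorlog 2 n + 3 + length (ain H v) + 2 * length (aout H v)"

lemma sum_weight: "sum weight (verts G) \<le> n * (floorlog 2 n + 3) + 3 * m"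
proof -
  have ends: "head G ` E \<subseteq> verts G" "tail G ` E \<subseteq> verts G" using arcs_H by auto
  have "(\<Sum>v\<in>verts G. length (ain H v)) = (\<Sum>v\<in>verts G. card {a \<in> E. head G a = v})"
    using in_H distinct_card by metis
  also have "\<dots> = card E"
    using sum.group[of E "verts G" "head G" "\<lambda>_. 1::nat"] ends by simp
  finally have 1: "(\<Sum>v\<in>verts G. length (ain H v)) = card E" .
  have "(\<Sum>v\<in>verts G. length (aout H v)) = (\<Sum>v\<in>verts G. card {a \<in> E. tail G a = v})"
    using out_H distinct_card by metis
  also have "\<dots> = card E"
    using sum.group[of E "verts G" "tail G" "\<lambda>_. 1::nat"] ends by simp
  finally have 2: "(\<Sum>v\<in>verts G. length (aout H v)) = card E" .
  have "card E \<le> m" using arcs_H by (simp add: card_mono)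
  with 1 2 show ?thesis by (simp add: weight_def sum.distrib sum_distrib_left[symmetric])
qed

lemma search_inv_length:
  assumes inv: "search_inv perm nx Q"
  shows "length (perm v) \<le> n"
proof (rule efficient_list_length[OF search_invD(1)[OF inv]])
  fix l assume l: "l \<in> set (perm v)"
  have lab: "path_label v l" "distinct (label_verts l)"
    using search_invD(2,3)[OF inv l] .
  then have "length (rev (snd (snd l))) < n"
    by (intro length_apath_less[of s _ v]) (auto simp: path_label_def Let_def apath_def)
  moreover have "fst (snd l) \<le> length (snd (snd l))"
    using lab length_filter_le[of on "rev (snd (snd l))"]
    by (simp add: path_label_def Let_def marked_def)
  ultimately show "fst (snd l) < n" by simp
qed

text \<open>
  Each extraction of \<open>v\<close> is paid by \<open>weight v\<close>, except for the inner loop of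
  \<^const>\<open>next_candidate\<close>, which is paid by the advance of the pointers \<open>nx\<close>.
\<close>

definition potential :: "('v \<Rightarrow> 'a label list) \<Rightarrow> ('a \<Rightarrow> nat) \<Rightarrow> nat" where
  "potential perm nx = (\<Sum>v\<in>verts G. length (perm v) * weight v) + sum nx E"

lemma potential_le:
  assumes inv: "search_inv perm nx Q"
  shows "potential perm nx \<le> max_potential"
proof -
  have "(\<Sum>v\<in>verts G. length (perm v) * weight v) \<le> n * sum weight (verts G)"
    unfolding sum_distrib_left by (intro sum_mono mult_right_mono search_inv_length[OF inv]) simp
  also have "\<dots> \<le> n * (n * (floorlog 2 n + 3) + 3 * m)"
    by (rule mult_le_mono2[OF sum_weight])
  finally have 1: "(\<Sum>v\<in>verts G. length (perm v) * weight v) \<le> n * (n * (floorlog 2 n + 3) + 3 * m)" .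
  have "sum nx E \<le> (\<Sum>a\<in>E. n)"
    using search_invD(12)[OF inv] search_inv_length[OF inv] by (intro sum_mono) (blast intro: le_trans)
  also have "\<dots> = card E * n" by simp
  also have "\<dots> \<le> m * n"
    using arcs_H by (intro mult_right_mono card_mono) auto
  finally show ?thesis using 1 unfolding potential_def max_potential_def by linarith
qed

definition optimal :: "'v \<Rightarrow> nat \<Rightarrow> real \<Rightarrow> 'a list \<Rightarrow> bool" where
  "optimal t g x p \<longleftrightarrow> apath s p t \<and> set p \<subseteq> E \<and> x = awalk_cost c p \<and> marked p < g \<and>
    (\<forall>w. awalk s w t \<longrightarrow> set w \<subseteq> E \<longrightarrow> marked w < g \<longrightarrow> x \<le> awalk_cost c w)"

definition loop_inv :: "'v \<Rightarrow> nat \<Rightarrow>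
    ('v \<Rightarrow> 'a label list) \<times> ('a \<Rightarrow> nat) \<times> ('v, 'a label) pq \<times> 'a label option \<Rightarrow> nat \<Rightarrow> bool" where
  "loop_inv t g = (\<lambda>(perm, nx, Q, res) T. case res of
     None \<Rightarrow> search_inv perm nx Q \<and> T \<le> potential perm nx \<and> (\<forall>l\<in>set (perm t). g \<le> fst (snd l))
   | Some l \<Rightarrow> optimal t g (fst l) (rev (snd (snd l))) \<and> T \<le> max_potential + floorlog 2 n + 2)"

lemma spec_put_best:
  assumes "\<And>T. T \<le> 1 \<Longrightarrow> P (Q(v := best)) T"
  shows "spec (case best of None \<Rightarrow> ret (Q(v := None)) | Some b \<Rightarrow> pq_put v b (Q(v := None))) P"
  using assms by (cases best) auto

lemma loop_inv_stop:
  assumes inv: "search_inv perm nx Q" and old: "\<forall>l\<in>set (perm t). g \<le> fst (snd l)"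
    and l: "Q t = Some l" and min: "\<forall>w b. Q w = Some b \<longrightarrow> lab_le l b" and g: "fst (snd l) < g"
  shows "optimal t g (fst l) (rev (snd (snd l)))"
proof -
  note lab = search_invD(5,6)[OF inv l]
  have "fst l \<le> awalk_cost c w" if w: "awalk s w t" "set w \<subseteq> E" "marked w < g" for w
    using search_inv_walk[OF inv w(1,2)]
  proof
    assume "\<exists>l'\<in>set (perm t). lab_dom l' (awalk_cost c w, marked w, [])"
    then show ?thesis using old w(3) by (fastforce simp: lab_dom_def)
  next
    assume "\<exists>u b. Q u = Some b \<and> lab_le b (awalk_cost c w, marked w, [])"
    then have "lab_le l (awalk_cost c w, marked w, [])" using min by (blast intro: lab_le_trans)
    then show ?thesis by (auto dest: lab_leD)
  qed
  with lab g show ?thesis by (simp add: optimal_def path_label_def Let_def apath_def)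
qed

lemma loop_step:
  assumes I: "loop_inv t g (perm, nx, Q, None) T" and Q: "\<not> pq_is_empty Q"
  defines "V \<equiv> (\<lambda>(perm, nx, Q, res). case res of None \<Rightarrow> Suc (n * n) - (\<Sum>v\<in>verts G. length (perm v)) | Some _ \<Rightarrow> 0)"
  shows "spec (do {
          (v, l, Q) \<leftarrow> pq_extract_min label_key Q;
          let perm = perm(v := perm v @ [l]);
          if v = t \<and> fst (snd l) < g then ret (perm, nx, Q, Some l)
          else do {
            (best, nx) \<leftarrow> next_candidate G c H on perm v nx;
            Q \<leftarrow> (case best of None \<Rightarrow> ret Q | Some b \<Rightarrow> pq_put v b Q);
            Q \<leftarrow> propagate G c H on perm v l Q;
            ret (perm, nx, Q, None) } })
    (\<lambda>st' T'. loop_inv t g st' (T + 1 + T') \<and> V st' < V (perm, nx, Q, None))"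
proof -
  have inv: "search_inv perm nx Q" and T: "T \<le> potential perm nx" and old: "\<forall>l\<in>set (perm t). g \<le> fst (snd l)"
    using I by (auto simp: loop_inv_def)
  note dom = search_inv_dom_queue[OF inv]
  have fin: "finite (dom Q)" using dom by (rule finite_subset) simp
  have fl: "floorlog 2 (card (dom Q)) \<le> floorlog 2 n"
    using dom by (intro floorlog_mono card_mono) auto
  have "(\<Sum>v\<in>verts G. length (perm v)) \<le> (\<Sum>v\<in>verts G. n)"
    by (intro sum_mono search_inv_length[OF inv])
  then have S: "(\<Sum>v\<in>verts G. length (perm v)) \<le> n * n" by simp
  show ?thesis
    unfolding spec_bind
  proof (rule spec_pq_extract_min[OF fin Q], goal_cases)
    case (1 v l)
    note l = 1(1)
    from 1(2) have min: "\<forall>w b. Q w = Some b \<longrightarrow> lab_le l b" by (simp add: lab_le_def)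
    have v: "v \<in> verts G" using l dom by blast
    let ?perm = "perm(v := perm v @ [l])"
    note ex = search_inv_extract[OF inv l min]
    have S': "(\<Sum>v\<in>verts G. length (?perm v)) = (\<Sum>v\<in>verts G. length (perm v)) + 1"
      using sum_length_append[OF _ v, of perm l "\<lambda>_. 1"] by (simp del: fun_upd_apply)
    have W': "(\<Sum>v\<in>verts G. length (?perm v) * weight v) =
        (\<Sum>v\<in>verts G. length (perm v) * weight v) + weight v"
      using sum_length_append[OF _ v, of perm l weight] by simp
    show ?case
    proof (cases "v = t \<and> fst (snd l) < g")
      case True
      then have "optimal t g (fst l) (rev (snd (snd l)))"
        using loop_inv_stop[OF inv old _ min] l by blast
      moreover have "V (?perm, nx, Q(v := None), Some l) < V (perm, nx, Q, None)"
        using S by (simp add: V_def)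
      moreover have "T \<le> max_potential" using T potential_le[OF inv] by simp
      ultimately show ?thesis
        unfolding prod.case Let_def if_P[OF True] spec_ret using fl by (simp add: loop_inv_def)
    next
      case False
      have sorted': "\<forall>v. efficient_list (?perm v)" using ex(1) by blast
      have nx': "\<forall>a\<in>E. nx a \<le> length (?perm (tail G a)) \<and>
          (\<forall>i<nx a. dominated (?perm (head G a)) (ext a (?perm (tail G a) ! i)))"
        using ex(3,4) by blast
      show ?thesis
        unfolding prod.case Let_def if_not_P[OF False] spec_bind
      proof (rule spec_mono[OF next_candidate_spec[OF sorted' nx']], goal_cases)
        case (1 r T1)
        obtain best nx' where r: "r = (best, nx')" by force
        have c: "T1 + sum nx E \<le> length (ain H v) + sum nx' E"
          "\<forall>a\<in>E. nx' a \<le> length (?perm (tail G a)) \<and>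
            (\<forall>i<nx' a. dominated (?perm (head G a)) (ext a (?perm (tail G a) ! i)))"
          "\<forall>b. best = Some b \<longrightarrow> \<not> dominated (?perm v) b \<and>
            (\<exists>a\<in>E. head G a = v \<and> (\<exists>l\<in>set (?perm (tail G a)). b = ext a l))"
          "\<forall>a\<in>E. head G a = v \<longrightarrow> (\<forall>l\<in>set (?perm (tail G a)).
            dominated (?perm v) (ext a l) \<or> (\<exists>b. best = Some b \<and> lab_le b (ext a l)))"
          using 1 unfolding r prod.case by blast+
        show ?case
          unfolding r prod.case spec_bind
        proof (rule spec_put_best, rule spec_mono[OF propagate_spec], unfold spec_ret, goal_cases)
          case (1 T2 Q' T3)
          then have inv': "search_inv ?perm nx' Q'"
            by (intro search_inv_step[OF inv l min c(2-4)]) blast+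
          have "T + 1 + (1 + floorlog 2 (card (dom Q)) + (T1 + (T2 + (T3 + 0)))) \<le> potential ?perm nx'"
            using T c(1) 1 fl W' unfolding potential_def weight_def by simp
          moreover have "\<forall>l\<in>set (?perm t). g \<le> fst (snd l)"
            using old False by auto
          moreover have "V (?perm, nx', Q', None) < V (perm, nx, Q, None)"
            unfolding V_def prod.case option.case S' using S by simp
          ultimately show ?case
            using inv' unfolding loop_inv_def prod.case option.case by blast
        qed
      qed
    qed
  qed
qed

lemma spec_bda:
  assumes "\<And>x p T. optimal t g x p \<Longrightarrow> T \<le> time_bda \<Longrightarrow> P (Some (x, p)) T"
    and "\<And>T. (\<And>w. awalk s w t \<Longrightarrow> set w \<subseteq> E \<Longrightarrow> g \<le> marked w) \<Longrightarrow> T \<le> time_bda \<Longrightarrow> P None T"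
  shows "spec (bda G c H on g s t) P"
proof -
  let ?V = "\<lambda>(perm :: 'v \<Rightarrow> 'a label list, nx :: 'a \<Rightarrow> nat, Q :: ('v, 'a label) pq, res :: 'a label option).
    case res of None \<Rightarrow> Suc (n * n) - (\<Sum>v\<in>verts G. length (perm v)) | Some _ \<Rightarrow> 0"
  have start: "loop_inv t g (\<lambda>_. [], \<lambda>_. 0, pq_empty(s := Some (0, 0, [])), None) 0"
    using search_inv_init by (simp add: loop_inv_def)
  show ?thesis
    unfolding bda_def spec_bind spec_new_array spec_pq_put
  proof (rule spec_mono[OF spec_while[where I = "loop_inv t g" and V = ?V, OF start]], goal_cases)
    case (1 st T)
    obtain perm nx Q res where st: "st = (perm, nx, Q, res)" by (cases st)
    have "res = None" and Q: "\<not> pq_is_empty Q" using 1(2) unfolding st by auto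
    then show ?case
      using loop_step[OF _ Q, of t g perm nx T] 1(1) unfolding st prod.case by blast
  next
    case (2 st T)
    obtain perm nx Q res where st: "st = (perm, nx, Q, res)" by (cases st)
    have size: "length (av H) \<le> n" "length (aa H) \<le> m" by (rule length_H)+
    show ?case
    proof (cases res)
      case None
      have inv: "search_inv perm nx Q" and T: "T \<le> potential perm nx"
        and t: "\<forall>l\<in>set (perm t). g \<le> fst (snd l)" and Q: "Q = pq_empty"
        using 2 by (auto simp: st None loop_inv_def pq_is_empty_def)
      have "g \<le> marked w" if w: "awalk s w t" "set w \<subseteq> E" for w
        using search_inv_walk[OF inv w] t by (fastforce simp: lab_dom_def Q pq_empty_def)
      then show ?thesis
        using T potential_le[OF inv] size unfolding st None
        by (auto simp: time_bda_def intro!: assms(2))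
    next
      case (Some l)
      have l: "optimal t g (fst l) (rev (snd (snd l)))" and T: "T \<le> max_potential + floorlog 2 n + 2"
        using 2 by (auto simp: st Some loop_inv_def)
      have "length (snd (snd l)) \<le> n"
        using l length_apath[of s "rev (snd (snd l))" t] by (simp add: optimal_def)
      moreover have "fold (\<lambda>a p. a # p) (snd (snd l)) [] = rev (snd (snd l))"
        by (simp add: fold_Cons_rev)
      ultimately show ?thesis
        using T size l unfolding st Some
        by (auto simp: time_bda_def intro!: assms(1))
    qed
  qed
qed

end

section \<open>Subproblems\<close>

locale kssp_input = fin_digraph G for G :: "('v, 'a) pre_digraph" +
  fixes vs :: "'v list" and es :: "'a list" and s t :: 'v and c :: "'a \<Rightarrow> real"
  assumes vs: "distinct vs" "set vs = verts G"
    and es: "distinct es" "set es = arcs G"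
    and s_in: "s \<in> verts G"
    and cost_nonneg: "a \<in> arcs G \<Longrightarrow> 0 \<le> c a"
begin

lemma length_input: "length vs = n" "length es = m"
  using distinct_card[OF vs(1)] distinct_card[OF es(1)] vs es by simp_all

lemma spec_subgraph_adj:
  assumes P: "\<And>H T. set (aa H) = {a \<in> arcs G. a \<notin> set bl \<and> tail G a \<notin> tail G ` set pre \<and> head G a \<notin> tail G ` set pre} \<Longrightarrow>
    (\<And>u. u \<in> verts G \<Longrightarrow> search G c H u) \<Longrightarrow>
    T = 4 * n + 2 * m + length pre + length bl \<Longrightarrow> P H T"
  shows "spec (subgraph_adj G vs es pre bl) P"
proof -
  define dv where "dv = fold (\<lambda>a dv. dv(tail G a := True)) pre (\<lambda>_. False)"
  define da where "da = fold (\<lambda>a da. da(a := True)) bl (\<lambda>_. False)"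
  have "fold (\<lambda>a dv. dv(tail G a := True)) xs f v \<longleftrightarrow> f v \<or> v \<in> tail G ` set xs" for xs f v
    by (induction xs arbitrary: f) auto
  then have dv: "dv v \<longleftrightarrow> v \<in> tail G ` set pre" for v by (simp add: dv_def)
  have "fold (\<lambda>a da. da(a := True)) xs f a \<longleftrightarrow> f a \<or> a \<in> set xs" for xs f and a :: 'a
    by (induction xs arbitrary: f) auto
  then have da: "da a \<longleftrightarrow> a \<in> set bl" for a by (simp add: da_def)
  have "length (fold (\<lambda>v ws. if dv v then ws else v # ws) xs ws) \<le> length xs + length ws" for xs ws
  proof (induction xs arbitrary: ws)
    case (Cons x xs)
    from Cons[of ws] Cons[of "x # ws"] show ?case by simp
  qed simp
  from this[of vs "[]"]
  have len: "length (fold (\<lambda>v ws. if dv v then ws else v # ws) vs []) \<le> n"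
    using length_input by simp
  define K where "K a \<longleftrightarrow> \<not> (da a \<or> dv (tail G a) \<or> dv (head G a))" for a
  have K: "da a \<or> dv (tail G a) \<or> dv (head G a) \<longleftrightarrow> \<not> K a" for a by (simp add: K_def)
  let ?I = "\<lambda>ys (es', os, ins) T. T = length ys \<and> length es' \<le> length ys \<and> set es' = {a \<in> set ys. K a} \<and>
    (\<forall>v. set (os v) = {a \<in> set ys. K a \<and> tail G a = v} \<and> distinct (os v)) \<and>
    (\<forall>v. set (ins v) = {a \<in> set ys. K a \<and> head G a = v} \<and> distinct (ins v))"
  show ?thesis
    unfolding subgraph_adj_def spec_bind spec_new_array spec_foreach_ret
      dv_def[symmetric] da_def[symmetric]
  proof (rule spec_mono[OF spec_foreach[where I = ?I]], goal_cases)
    case (2 ys a zs st T)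
    then have "a \<notin> set ys" using es(1) by auto
    with 2(2) show ?case unfolding K by (cases st; cases "K a") auto
  next
    case (3 st T)
    obtain es' os ins where st: "st = (es', os, ins)" by (cases st)
    have I: "?I es (es', os, ins) T" using 3 by (simp only: st)
    show ?case
      unfolding st prod.case spec_ret
    proof (rule P, goal_cases)
      case 1
      then show ?case using I es(2) by (auto simp: K_def dv da)
    next
      case (2 u)
      show ?case
        using I es(2) length_input len cost_nonneg \<open>u \<in> verts G\<close> by unfold_locales auto
    qed (use I length_input in simp)
  qed auto
qed

definition time_second :: nat where
  "time_second = time_bda + 6 * n + 4 * m"

lemma spec_bda_2ssp:
  assumes "search G c H u"
    and p: "length p < n"
    and some: "\<And>x q T. search.optimal G c H (\<lambda>a. a \<in> set p) u t (length p) x q \<Longrightarrow>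
      T \<le> time_bda + m + n \<Longrightarrow> P (Some (x, q)) T"
    and none: "\<And>T. (\<And>w. awalk u w t \<Longrightarrow> set w \<subseteq> set (aa H) \<Longrightarrow> length p \<le> length (filter (\<lambda>a. a \<in> set p) w)) \<Longrightarrow>
      T \<le> time_bda + m + n \<Longrightarrow> P None T"
  shows "spec (bda_2ssp G c H u t p) P"
proof -
  interpret search G c H "\<lambda>a. a \<in> set p" u by fact
  let ?I = "\<lambda>ys (on, g) T. T = length ys \<and> on = (\<lambda>a. a \<in> set ys) \<and> g = length ys"
  show ?thesis
    unfolding bda_2ssp_def spec_bind spec_new_array
  proof (rule spec_mono[OF spec_foreach[where I = ?I]], goal_cases)
    case (3 st T)
    then have st: "st = (\<lambda>a. a \<in> set p, length p)" "T = length p" by auto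
    show ?case
      unfolding st prod.case
      by (rule spec_bda) (use length_H(2) p in \<open>auto simp: marked_def intro!: some none\<close>)
  qed (auto simp: fun_eq_iff)
qed

lemma spec_shortest_path:
  assumes "search G c H u"
    and some: "\<And>x q T. apath u q t \<Longrightarrow>
      (\<And>w. awalk u w t \<Longrightarrow> set w \<subseteq> set (aa H) \<Longrightarrow> awalk_cost c q \<le> awalk_cost c w) \<Longrightarrow>
      T \<le> time_bda + m \<Longrightarrow> P (Some (x, q)) T"
    and none: "\<And>T. (\<And>w. awalk u w t \<Longrightarrow> \<not> set w \<subseteq> set (aa H)) \<Longrightarrow>
      T \<le> time_bda + m \<Longrightarrow> P None T"
  shows "spec (shortest_path G c H u t) P"
proof -
  interpret search G c H "\<lambda>_. False" u by fact
  have [simp]: "marked w = 0" for w by (simp add: marked_def)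
  show ?thesis
    unfolding shortest_path_def spec_bind spec_new_array
    by (rule spec_bda) (use length_H(2) in \<open>fastforce simp: optimal_def intro: some none\<close>)+
qed

lemma awalk_verts_append_tails:
  "cas u p v \<Longrightarrow> awalk_verts u (p @ q) = map (tail G) p @ awalk_verts v q"
  by (induction p arbitrary: u) auto

lemma apath_append_iff_tails:
  assumes "awalk u p v"
  shows "apath u (p @ q) w \<longleftrightarrow> apath v q w \<and> distinct (map (tail G) p) \<and>
    tail G ` set p \<inter> set (awalk_verts v q) = {}"
proof -
  have "cas u p v" using assms by (simp add: awalk_def)
  from awalk_verts_append_tails[OF this] have "awalk_verts u (p @ q) = map (tail G) p @ awalk_verts v q" .
  moreover have "awalk u (p @ q) w \<longleftrightarrow> awalk v q w"
    using assms awalk_ends[of u p v] by (auto simp: awalk_append_iff)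
  ultimately show ?thesis by (auto simp: apath_def)
qed

lemma awalk_target_in_verts: "awalk u p v \<Longrightarrow> v \<in> set (awalk_verts u p)"
  using last_in_set[OF awalk_verts_non_Nil, of u p] by simp

lemma awalk_first_hit:
  assumes "awalk v r w" "w \<in> W"
  obtains y1 y2 z where "r = y1 @ y2" "awalk v y1 z" "awalk z y2 w" "z \<in> W" "\<forall>a\<in>set y1. tail G a \<notin> W"
proof -
  have "\<exists>y1 y2 z. r = y1 @ y2 \<and> awalk v y1 z \<and> awalk z y2 w \<and> z \<in> W \<and> (\<forall>a\<in>set y1. tail G a \<notin> W)"
    using assms
  proof (induction r arbitrary: v)
    case Nil
    then show ?case by (auto simp: awalk_simps)
  next
    case (Cons a r)
    show ?case
    proof (cases "v \<in> W")
      case True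
      then show ?thesis using Cons.prems awalk_hd_in_verts[OF Cons.prems(1)]
        by (intro exI[of _ "[]"] exI[of _ "a # r"] exI[of _ v]) (auto simp: awalk_simps)
    next
      case False
      have a: "a \<in> arcs G" "tail G a = v" "awalk (head G a) r w"
        using Cons.prems(1) by (auto simp: awalk_simps)
      obtain y1 y2 z where *: "r = y1 @ y2" "awalk (head G a) y1 z" "awalk z y2 w" "z \<in> W" "\<forall>a\<in>set y1. tail G a \<notin> W"
        using Cons.IH[OF a(3) Cons.prems(2)] by blast
      with a False show ?thesis
        by (intro exI[of _ "a # y1"] exI[of _ y2] exI[of _ z]) (auto simp: awalk_simps)
    qed
  qed
  with that show ?thesis by blast
qed

definition pre :: "('v, 'a) subproblem \<Rightarrow> 'a list" where
  "pre P = rev (rev_prefix P)"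

definition gone :: "('v, 'a) subproblem \<Rightarrow> 'v set" where
  "gone P = tail G ` set (rev_prefix P)"

definition walk_avoiding :: "'v set \<Rightarrow> 'v \<Rightarrow> 'a list \<Rightarrow> bool" where
  "walk_avoiding D u w \<longleftrightarrow> awalk u w t \<and> set (awalk_verts u w) \<inter> D = {}"

definition valid :: "('v, 'a) subproblem \<Rightarrow> bool" where
  "valid P \<longleftrightarrow> awalk s (pre P) (source P) \<and> apath s (pre P @ suffix P) t \<and>
    prefix_cost P = awalk_cost c (pre P) \<and>
    distinct (blocked P) \<and> set (blocked P) \<subseteq> arcs G \<and>
    tail G ` set (blocked P) \<subseteq> tail G ` set (suffix P) \<and> set (blocked P) \<inter> set (suffix P) = {} \<and>
    (\<forall>w. walk_avoiding (gone P) (source P) w \<longrightarrow> awalk_cost c (suffix P) \<le> awalk_cost c w)"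

definition deviates :: "'a list \<Rightarrow> 'a list \<Rightarrow> 'a \<Rightarrow> bool" where
  "deviates p r d \<longleftrightarrow> (\<exists>x e p' r'. p = x @ e # p' \<and> r = x @ d # r' \<and> d \<noteq> e)"

text \<open>
  The paths that a subproblem still stands for.  Arcs in \<open>blocked\<close> are forbidden only as first
  deviation from the suffix; the search removes them altogether, which by the lemma
  \<open>exchange\<close> does not change the minimal cost.
\<close>

definition open_paths :: "('v, 'a) subproblem \<Rightarrow> 'a list set" where
  "open_paths P = {r. apath s (pre P @ r) t \<and> (\<exists>d. deviates (suffix P) r d \<and> d \<notin> set (blocked P))}"

definition full_paths :: "('v, 'a) subproblem \<Rightarrow> 'a list set" where
  "full_paths P = (\<lambda>r. pre P @ r) ` open_paths P"

lemma deviation_unique: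
  "x @ e # p = x' @ e' # p' \<Longrightarrow> x @ d # r = x' @ d' # r' \<Longrightarrow> d \<noteq> e \<Longrightarrow> d' \<noteq> e' \<Longrightarrow>
    x = x' \<and> e = e' \<and> d = d' \<and> p = p' \<and> r = r'"
proof (induction x arbitrary: x')
  case Nil
  then show ?case by (cases x') auto
next
  case (Cons a x)
  then show ?case by (cases x') auto
qed

lemma deviation_exists:
  assumes "apath u p v" "apath u r v" "p \<noteq> r"
  shows "\<exists>d. deviates p r d"
  using assms
proof (induction p arbitrary: u r)
  case Nil
  then show ?case
    by (cases r) (auto simp: apath_simps apath_def[of "head G _"] dest: awalk_target_in_verts)
next
  case (Cons e p)
  show ?case
  proof (cases r)
    case Nil
    then show ?thesis using Cons.prems
      by (auto simp: apath_simps apath_def[of "head G _"] dest: awalk_target_in_verts)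
  next
    case (Cons d r')
    show ?thesis
    proof (cases "d = e")
      case True
      with Cons.IH[of "head G e" r'] Cons.prems Cons have "\<exists>d. deviates p r' d"
        by (auto simp: apath_simps)
      then obtain f x e' p' r'' where "p = x @ e' # p'" "r' = x @ f # r''" "f \<noteq> e'"
        unfolding deviates_def by blast
      then have "deviates (e # p) r f"
        unfolding deviates_def using Cons True by (intro exI[of _ "e # x"]) auto
      then show ?thesis by blast
    next
      case False
      then have "deviates (e # p) r d"
        unfolding deviates_def using Cons by (intro exI[of _ "[]"]) auto
      then show ?thesis by blast
    qed
  qed
qed

lemma validD:
  assumes "valid P"
  shows "awalk s (pre P) (source P)" "apath (source P) (suffix P) t"
    "gone P \<inter> set (awalk_verts (source P) (suffix P)) = {}"
    "source P \<notin> gone P" "source P \<in> verts G"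
    "distinct (map (tail G) (suffix P))"
proof -
  show a: "awalk s (pre P) (source P)" using assms by (simp add: valid_def)
  have "apath s (pre P @ suffix P) t" using assms by (simp add: valid_def)
  then show *: "apath (source P) (suffix P) t" "gone P \<inter> set (awalk_verts (source P) (suffix P)) = {}"
    unfolding apath_append_iff_tails[OF a] by (auto simp: gone_def pre_def)
  then have "awalk (source P) (suffix P) t" by (simp add: apath_def)
  then show "source P \<notin> gone P" "source P \<in> verts G"
    using *(2) by (auto dest: hd_in_awalk_verts)
  show "distinct (map (tail G) (suffix P))"
    using *(1) by (auto simp: apath_def awalk_verts_conv split: if_splits)
qed


lemma walk_avoiding_iff:
  "walk_avoiding D u w \<longleftrightarrow>
    awalk u w t \<and> u \<notin> D \<and> (\<forall>a\<in>set w. tail G a \<notin> D \<and> head G a \<notin> D)"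
proof (cases "awalk u w t")
  case True
  show ?thesis
    unfolding walk_avoiding_def set_awalk_verts[OF True] disjoint_iff set_map by auto
qed (simp add: walk_avoiding_def)

lemma open_pathsD:
  assumes "valid P" "r \<in> open_paths P"
  obtains x e p' d r' where "suffix P = x @ e # p'" "r = x @ d # r'" "d \<noteq> e" "d \<notin> set (blocked P)"
    "d \<in> arcs G" "tail G d = tail G e" "awalk (source P) x (tail G e)"
    "walk_avoiding (gone P \<union> tail G ` set (x @ [e])) (head G d) r'"
proof -
  from assms(2) obtain x e p' d r' where *: "suffix P = x @ e # p'" "r = x @ d # r'" "d \<noteq> e"
    "d \<notin> set (blocked P)" and ap: "apath s (pre P @ r) t"
    by (auto simp: open_paths_def deviates_def)
  have "apath (source P) (x @ d # r') t"
    using ap apath_append_iff_tails[OF validD(1)[OF assms(1)]] *(2) by blast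
  then have x: "awalk (source P) x (tail G d)" and d: "d \<in> arcs G"
    by (auto simp: apath_def awalk_append_iff awalk_simps)
  have "awalk (source P) (x @ e # p') t"
    using validD(2)[OF assms(1)] *(1) by (simp add: apath_def)
  then have tail: "tail G d = tail G e"
    using x by (auto simp: awalk_append_iff awalk_simps dest: awalk_ends)
  have "awalk s (pre P @ x @ [d]) (head G d)"
    using validD(1)[OF assms(1)] x d by (auto simp: awalk_append_iff awalk_simps)
  from apath_append_iff_tails[OF this, of r' t] ap *(2)
  have "walk_avoiding (gone P \<union> tail G ` set (x @ [e])) (head G d) r'"
    using tail by (auto simp: walk_avoiding_def gone_def pre_def apath_def)
  with * x d tail that show ?thesis by simp
qed

text \<open>
  After deviating, follow \<open>r\<close> until it first meets the rest of the suffix again and then stay on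
  the suffix, which is a shortest way to \<open>t\<close>.
\<close>

lemma exchange:
  assumes P: "valid P" and p: "suffix P = x @ e # p'"
    and d: "d \<noteq> e" "d \<notin> set (blocked P)" "d \<in> arcs G" "tail G d = tail G e"
    and r: "walk_avoiding (gone P \<union> tail G ` set (x @ [e])) (head G d) r"
  obtains w where "walk_avoiding (gone P) (source P) w" "set w \<inter> set (blocked P) = {}"
    "length (filter (\<lambda>a. a \<in> set (suffix P)) w) < length (suffix P)"
    "awalk_cost c w \<le> awalk_cost c (x @ d # r)"
proof -
  let ?u = "source P" and ?p = "suffix P"
  have p_walk: "awalk ?u ?p t" using validD(2)[OF P] by (simp add: apath_def)
  then have x: "awalk ?u x (tail G e)" and p': "awalk (head G e) p' t" and e: "e \<in> arcs G"
    by (auto simp: p awalk_append_iff awalk_simps)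
  have r_walk: "awalk (head G d) r t" using r by (simp add: walk_avoiding_def)
  let ?W = "set (awalk_verts (head G e) p')"
  obtain y1 y2 z where y: "r = y1 @ y2" "awalk (head G d) y1 z" "awalk z y2 t" "z \<in> ?W"
      "\<forall>a\<in>set y1. tail G a \<notin> ?W"
    by (rule awalk_first_hit[OF r_walk awalk_target_in_verts[OF p']])
  from awalk_decomp[OF p' y(4)] obtain w1 w2
    where w: "p' = w1 @ w2" "awalk (head G e) w1 z" "awalk z w2 t" by auto
  let ?w = "x @ d # y1 @ w2" and ?w' = "x @ e # w1 @ y2"
  have walk: "awalk ?u ?w t" "awalk ?u ?w' t"
    using x d(3,4) e y(2,3) w(2,3) by (auto simp: awalk_Cons_iff dest: awalk_last_in_verts intro!: awalk_appendI)
  have avoid_r: "head G d \<notin> gone P"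
      "a \<in> set r \<Longrightarrow> tail G a \<notin> gone P \<union> tail G ` set (x @ [e])"
      "a \<in> set r \<Longrightarrow> head G a \<notin> gone P" for a
    using r unfolding walk_avoiding_iff by blast+
  have "walk_avoiding (gone P) ?u ?p"
    using p_walk validD(3)[OF P] unfolding walk_avoiding_def by blast
  then have avoid_p: "tail G a \<notin> gone P \<and> head G a \<notin> gone P" if "a \<in> set ?p" for a
    using that unfolding walk_avoiding_iff by blast
  have avoid: "walk_avoiding (gone P) ?u ?w" "walk_avoiding (gone P) ?u ?w'"
  proof -
    have "tail G a \<notin> gone P \<and> head G a \<notin> gone P" if "a \<in> set ?w \<union> set ?w'" for a
    proof (cases "a = d")
      case True
      then show ?thesis using avoid_r(1) avoid_p[of e] d(4) p by simp
    next
      case False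
      then have "a \<in> set ?p \<union> set r" using that unfolding p w(1) y(1) by auto
      then show ?thesis using avoid_p[of a] avoid_r(2,3)[of a] by blast
    qed
    moreover have "?u \<notin> gone P" by (rule validD(4)[OF P])
    ultimately show "walk_avoiding (gone P) ?u ?w" "walk_avoiding (gone P) ?u ?w'"
      using walk unfolding walk_avoiding_iff by blast+
  qed
  have y1_tail: "tail G a \<notin> tail G ` set ?p" if "a \<in> set y1" for a
  proof -
    have "tail G ` set p' \<subseteq> ?W"  by (auto simp: set_awalk_verts[OF p'])
    then have "tail G a \<notin> tail G ` set p'" using y(5) that by blast
    moreover have "tail G a \<notin> tail G ` set (x @ [e])"
      using avoid_r(2)[of a] that y(1) by auto
    ultimately show ?thesis by (auto simp: p)
  qed
  then have y1_p: "set y1 \<inter> set ?p = {}" by blast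
  have inj: "inj_on (tail G) (set ?p)"
    using validD(6)[OF P] by (simp add: distinct_map)
  have d_p: "d \<notin> set ?p"
    using inj_onD[OF inj d(4)] d(1) by (auto simp: p)
  have bl: "tail G ` set (blocked P) \<subseteq> tail G ` set ?p" "set (blocked P) \<inter> set ?p = {}"
    using P by (simp_all add: valid_def)
  have "set ?w \<inter> set (blocked P) = {}"
  proof -
    have "set y1 \<inter> set (blocked P) = {}" using bl(1) y1_tail by blast
    moreover have "set x \<subseteq> set ?p" "set w2 \<subseteq> set ?p" by (auto simp: p w)
    ultimately show ?thesis using bl(2) d(2) by auto
  qed
  moreover have "length (filter (\<lambda>a. a \<in> set ?p) ?w) < length ?p"
  proof -
    have "filter (\<lambda>a. a \<in> set ?p) y1 = []" using y1_p by (auto simp: filter_empty_conv)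
    then have "length (filter (\<lambda>a. a \<in> set ?p) ?w) =
        length (filter (\<lambda>a. a \<in> set ?p) x) + length (filter (\<lambda>a. a \<in> set ?p) w2)"
      using d_p by simp
    also have "\<dots> \<le> length x + length w2" by (intro add_mono length_filter_le)
    also have "\<dots> < length (x @ e # p')" by (simp add: w)
    finally show ?thesis unfolding p .
  qed
  moreover have "awalk_cost c ?w \<le> awalk_cost c (x @ d # r)"
  proof -
    have "awalk_cost c ?p \<le> awalk_cost c ?w'"
      using avoid(2) P unfolding valid_def by blast
    then show ?thesis by (simp add: p w(1) y(1))
  qed
  ultimately show ?thesis using that avoid(1) by blast
qed

text \<open>
  Minimality over walks instead of simple paths is what makes the rest of \<open>q\<close> a shortest suffix
  for the subproblem that starts after the deviation arc.
\<close>

definition second :: "('v, 'a) subproblem \<Rightarrow> 'a list \<Rightarrow> bool" where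
  "second P q \<longleftrightarrow> q \<in> open_paths P \<and>
    (\<forall>x e p' d r. suffix P = x @ e # p' \<longrightarrow> d \<noteq> e \<longrightarrow> d \<notin> set (blocked P) \<longrightarrow> d \<in> arcs G \<longrightarrow>
      tail G d = tail G e \<longrightarrow> walk_avoiding (gone P \<union> tail G ` set (x @ [e])) (head G d) r \<longrightarrow>
      awalk_cost c q \<le> awalk_cost c (x @ d # r))"

lemma second_min:
  assumes "valid P" "second P q" "r \<in> open_paths P"
  shows "awalk_cost c q \<le> awalk_cost c r"
  using assms(2) open_pathsD[OF assms(1,3)] unfolding second_def by metis

lemma spec_solve:
  assumes P: "valid P"
    and some: "\<And>q T. second P q \<Longrightarrow> T \<le> time_second \<Longrightarrow> R (Some (awalk_cost c q, q)) T"
    and none: "\<And>T. open_paths P = {} \<Longrightarrow> T \<le> time_second \<Longrightarrow> R None T"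
  shows "spec (do { H \<leftarrow> subgraph_adj G vs es (rev_prefix P) (blocked P);
     bda_2ssp G c H (source P) t (suffix P) }) R"
  unfolding spec_bind
proof (rule spec_subgraph_adj, goal_cases)
  case (1 H T)
  let ?u = "source P" and ?p = "suffix P" and ?on = "\<lambda>a. a \<in> set (suffix P)"
  have u: "?u \<in> verts G" "?u \<notin> gone P" using validD[OF P] by blast+
  have search: "search G c H ?u" using 1(2) u by blast
  interpret S: search G c H ?on ?u by (rule search)
  have E: "a \<in> set (aa H) \<longleftrightarrow> a \<in> arcs G \<and> a \<notin> set (blocked P) \<and> tail G a \<notin> gone P \<and> head G a \<notin> gone P" for a
    using 1(1) by (simp add: gone_def)
  have walk: "set w \<subseteq> set (aa H) \<longleftrightarrow> walk_avoiding (gone P) ?u w \<and> set w \<inter> set (blocked P) = {}"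
    if "awalk ?u w t" for w
  proof -
    have "set w \<subseteq> arcs G" using that by (simp add: awalk_def)
    then have "a \<in> set (aa H) \<longleftrightarrow> a \<notin> set (blocked P) \<and> tail G a \<notin> gone P \<and> head G a \<notin> gone P"
      if "a \<in> set w" for a using that E[of a] by blast
    then show ?thesis
      using that u(2) unfolding walk_avoiding_iff subset_iff disjoint_iff by blast
  qed
  have p: "apath ?u ?p t" "length ?p < n" using validD(2)[OF P] by (auto intro: length_apath_less)
  have "length (pre P @ ?p) < n"
    using P length_apath_less[of s "pre P @ ?p" t] by (simp add: valid_def)
  then have lpre: "length (rev_prefix P) \<le> n" by (simp add: pre_def)
  have lbl: "length (blocked P) \<le> m"
    using P distinct_card[of "blocked P"] card_mono[OF finite_arcs, of "set (blocked P)"]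
    by (simp add: valid_def)
  have time: "T + T' \<le> time_second" if "T' \<le> time_bda + m + n" for T'
    using that 1(3) lpre lbl unfolding time_second_def by simp
  have exch: "\<exists>w. awalk ?u w t \<and> set w \<subseteq> set (aa H) \<and> length (filter ?on w) < length ?p \<and>
      awalk_cost c w \<le> awalk_cost c (x @ d # r)"
    if "suffix P = x @ e # p'" "d \<noteq> e" "d \<notin> set (blocked P)" "d \<in> arcs G" "tail G d = tail G e"
      "walk_avoiding (gone P \<union> tail G ` set (x @ [e])) (head G d) r" for x e p' d r
    using exchange[OF P that] walk unfolding walk_avoiding_def by metis
  show ?case
  proof (rule spec_bda_2ssp[OF search p(2)], goal_cases)
    case (1 x q T')
    then have q: "apath ?u q t" "set q \<subseteq> set (aa H)" "x = awalk_cost c q" "length (filter ?on q) < length ?p"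
      and min: "\<And>w. awalk ?u w t \<Longrightarrow> set w \<subseteq> set (aa H) \<Longrightarrow> length (filter ?on w) < length ?p \<Longrightarrow>
        awalk_cost c q \<le> awalk_cost c w"
      by (auto simp: S.optimal_def S.marked_def)
    have "?p \<noteq> q" using q(4) by auto
    then obtain d where d: "deviates ?p q d" using deviation_exists[OF p(1) q(1)] by blast
    then have "d \<in> set q" by (auto simp: deviates_def)
    then have "d \<notin> set (blocked P)" using q(2) E by blast
    moreover have "apath s (pre P @ q) t"
    proof -
      have "walk_avoiding (gone P) ?u q" using walk q(1,2) by (simp add: apath_def)
      moreover have "distinct (map (tail G) (pre P))"
        using P apath_append_iff_tails[OF validD(1)[OF P]] by (simp add: valid_def)
      ultimately show ?thesis
        using q(1) unfolding apath_append_iff_tails[OF validD(1)[OF P]]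
        by (auto simp: walk_avoiding_def gone_def pre_def)
    qed
    ultimately have "q \<in> open_paths P" using d by (auto simp: open_paths_def)
    moreover have "awalk_cost c q \<le> awalk_cost c (x @ d # r)"
      if "suffix P = x @ e # p'" "d \<noteq> e" "d \<notin> set (blocked P)" "d \<in> arcs G" "tail G d = tail G e"
      "walk_avoiding (gone P \<union> tail G ` set (x @ [e])) (head G d) r" for x e p' d r
      using exch[OF that] min by (meson order_trans)
    ultimately have "second P q" unfolding second_def by blast
    then show ?case using some time[OF 1(2)] q(3) by blast
  next
    case (2 T')
    have "r \<notin> open_paths P" for r
    proof
      assume "r \<in> open_paths P"
      then obtain w where "awalk ?u w t" "set w \<subseteq> set (aa H)" "length (filter ?on w) < length ?p"
        using open_pathsD[OF P] exch by metis
      with 2(1)[of w] show False by simp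
    qed
    then show ?case using none time[OF 2(2)] by blast
  qed
qed

lemma split_valid:
  assumes P: "valid P" and q: "second P q"
    and x: "suffix P = x @ e # p'" "q = x @ d # q'" "d \<noteq> e"
  defines "P1 \<equiv> P\<lparr> blocked := d # blocked P \<rparr>"
    and "P2 \<equiv> \<lparr> rev_prefix = d # rev x @ rev_prefix P, prefix_cost = prefix_cost P + awalk_cost c x + c d,
        source = head G d, suffix = q', blocked = [] \<rparr>"
  shows "valid P1" "valid P2"
    "full_paths P = insert (pre P @ q) (full_paths P1 \<union> full_paths P2)"
    "pre P @ q \<notin> full_paths P1" "pre P @ q \<notin> full_paths P2"
    "full_paths P1 \<inter> full_paths P2 = {}"
proof -
  let ?D = "gone P \<union> tail G ` set (x @ [e])"
  have q_open: "q \<in> open_paths P" using q by (simp add: second_def)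
  obtain y f p'' g r where y: "suffix P = y @ f # p''" "q = y @ g # r" "g \<noteq> f"
    and g: "g \<notin> set (blocked P)" "g \<in> arcs G" "tail G g = tail G f" "awalk (source P) y (tail G f)"
      "walk_avoiding (gone P \<union> tail G ` set (y @ [f])) (head G g) r"
    by (rule open_pathsD[OF P q_open])
  have "x = y \<and> e = f \<and> d = g \<and> p' = p'' \<and> q' = r"
    using deviation_unique[of x e p' y f p'' d q' g r] x y by simp
  with g have d_props: "d \<notin> set (blocked P)" "d \<in> arcs G" "tail G d = tail G e"
      "awalk (source P) x (tail G e)" "walk_avoiding ?D (head G d) q'" by blast+
  have ap: "apath s (pre P @ q) t" using q_open by (simp add: open_paths_def)
  have inj: "inj_on (tail G) (set (suffix P))"
    using validD(6)[OF P] by (simp add: distinct_map)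
  have "d \<notin> set (suffix P)"
    using inj_onD[OF inj d_props(3)] x(3) by (auto simp: x(1))
  then show "valid P1"
    using P d_props(1-3) x(1)
    by (auto simp: P1_def valid_def pre_def gone_def)
  have pre2: "pre P2 = pre P @ x @ [d]" by (simp add: P2_def pre_def)
  have gone2: "gone P2 = ?D" using d_props(3) by (auto simp: P2_def gone_def)
  show V2: "valid P2"
    unfolding valid_def
  proof (intro conjI allI impI)
    have "awalk s (pre P @ x @ [d]) (head G d)"
      using validD(1)[OF P] d_props by (auto simp: awalk_append_iff awalk_simps)
    then show "awalk s (pre P2) (source P2)" unfolding pre2 by (simp add: P2_def)
  next
    show "apath s (pre P2 @ suffix P2) t" using ap by (simp add: pre2 x(2)) (simp add: P2_def)
    show "prefix_cost P2 = awalk_cost c (pre P2)"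
      using P by (simp add: pre2) (simp add: P2_def valid_def)
  next
    fix w assume "walk_avoiding (gone P2) (source P2) w"
    then have "walk_avoiding ?D (head G d) w" unfolding gone2 by (simp add: P2_def)
    then have "awalk_cost c q \<le> awalk_cost c (x @ d # w)"
      using q x(1,3) d_props(1-3) unfolding second_def by blast
    then show "awalk_cost c (suffix P2) \<le> awalk_cost c w" by (simp add: x(2)) (simp add: P2_def)
  qed (simp_all add: P2_def)
  have open1: "r \<in> open_paths P1 \<longleftrightarrow> r \<in> open_paths P \<and> (\<forall>r'. r \<noteq> x @ d # r')" for r
  proof
    assume r: "r \<in> open_paths P1"
    then obtain y f p'' g r' where y: "suffix P = y @ f # p''" "r = y @ g # r'" "g \<noteq> f"
      "g \<notin> set (blocked P)" "g \<noteq> d" and apr: "apath s (pre P @ r) t"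
      by (auto simp: open_paths_def deviates_def P1_def pre_def)
    then have "r \<in> open_paths P" by (auto simp: open_paths_def deviates_def)
    moreover have "r \<noteq> x @ d # r''" for r''
      using deviation_unique[of x e p' y f p'' d r'' g r'] x y by metis
    ultimately show "r \<in> open_paths P \<and> (\<forall>r'. r \<noteq> x @ d # r')" by blast
  next
    assume r: "r \<in> open_paths P \<and> (\<forall>r'. r \<noteq> x @ d # r')"
    then obtain y f p'' g r' where y: "suffix P = y @ f # p''" "r = y @ g # r'" "g \<noteq> f"
      "g \<notin> set (blocked P)" "tail G g = tail G f"
      using open_pathsD[OF P] by metis
    have "g \<noteq> d"
    proof
      assume "g = d"
      then have "tail G f = tail G e" using y(5) d_props(3) by simp
      then have "f = e" using inj_onD[OF inj, of f e] x(1) y(1) by (metis in_set_conv_decomp)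
      have "distinct (suffix P)" using validD(6)[OF P] by (simp add: distinct_map)
      then have "e \<notin> set x" "e \<notin> set p'" using x(1) by auto
      then have "y = x" using x(1) y(1) \<open>f = e\<close> append_Cons_eq_iff[of e x p' y p''] by simp
      then show False using r y(2) \<open>g = d\<close> by blast
    qed
    with r y show "r \<in> open_paths P1"
      by (auto simp: open_paths_def deviates_def P1_def pre_def)
  qed
  have open2: "r' \<in> open_paths P2 \<longleftrightarrow> x @ d # r' \<in> open_paths P \<and> r' \<noteq> q'" for r'
  proof
    assume r': "r' \<in> open_paths P2"
    then have "apath s (pre P @ x @ d # r') t" by (simp add: open_paths_def pre2)
    then have "x @ d # r' \<in> open_paths P"
      using x(1,3) d_props(1) by (auto simp: open_paths_def deviates_def)
    moreover have "r' \<noteq> q'" using r' by (auto simp: open_paths_def deviates_def P2_def)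
    ultimately show "x @ d # r' \<in> open_paths P \<and> r' \<noteq> q'" by blast
  next
    assume r': "x @ d # r' \<in> open_paths P \<and> r' \<noteq> q'"
    then have ap2: "apath s (pre P2 @ r') t" by (simp add: open_paths_def pre2)
    then have "apath (source P2) r' t" using apath_append_iff_tails[OF validD(1)[OF V2]] by blast
    moreover have "suffix P2 \<noteq> r'" using r' by (auto simp: P2_def)
    ultimately obtain g where "deviates (suffix P2) r' g"
      using deviation_exists[OF validD(2)[OF V2]] by blast
    with ap2 show "r' \<in> open_paths P2" by (auto simp: open_paths_def P2_def)
  qed
  have pre1: "pre P1 = pre P" by (simp add: P1_def pre_def)
  have full1: "pre P @ r \<in> full_paths P1 \<longleftrightarrow> r \<in> open_paths P1" for r
    by (auto simp: full_paths_def pre1)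
  have full2: "pre P @ r \<in> full_paths P2 \<longleftrightarrow> (\<exists>r'. r = x @ d # r' \<and> r' \<in> open_paths P2)" for r
    by (auto simp: full_paths_def pre2)
  have full: "pre P @ r \<in> full_paths P \<longleftrightarrow> r \<in> open_paths P" for r
    by (auto simp: full_paths_def)
  have ex: "f \<in> full_paths P1 \<union> full_paths P2 \<union> full_paths P \<Longrightarrow> \<exists>r. f = pre P @ r" for f
    by (auto simp: full_paths_def pre1 pre2)
  show "pre P @ q \<notin> full_paths P1" using x(2) by (auto simp: full1 open1)
  show "pre P @ q \<notin> full_paths P2" using x(2) by (auto simp: full2 open2)
  have "f \<notin> full_paths P2" if "f \<in> full_paths P1" for f
    using ex[of f] that by (auto simp: full1 full2 open1)
  then show "full_paths P1 \<inter> full_paths P2 = {}" by blast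
  have "r \<in> open_paths P \<longleftrightarrow> r = q \<or> r \<in> open_paths P1 \<or> (\<exists>r'. r = x @ d # r' \<and> r' \<in> open_paths P2)" for r
    unfolding open1 open2 using q_open x(2) by blast
  then have "f \<in> full_paths P \<longleftrightarrow> f \<in> insert (pre P @ q) (full_paths P1 \<union> full_paths P2)" if "\<exists>r. f = pre P @ r" for f
    using that by (auto simp: full full1 full2)
  then show "full_paths P = insert (pre P @ q) (full_paths P1 \<union> full_paths P2)"
    using ex by blast
qed


section \<open>The Roditty-Zwick scheme\<close>

definition family :: "(nat, ('v, 'a) candidate) pq \<Rightarrow> nat \<Rightarrow> 'a list set" where
  "family Q i = (case Q i of None \<Rightarrow> {} | Some (X, P, q) \<Rightarrow> full_paths P)"

definition queue_ok :: "(nat, ('v, 'a) candidate) pq \<Rightarrow> nat \<Rightarrow> bool" where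
  "queue_ok Q N \<longleftrightarrow> dom Q \<subseteq> {..<N} \<and> disjoint_family (family Q) \<and>
    (\<forall>i X P q. Q i = Some (X, P, q) \<longrightarrow> valid P \<and> second P q \<and> X = awalk_cost c (pre P @ q))"

definition cover :: "(nat, ('v, 'a) candidate) pq \<Rightarrow> 'a list set" where
  "cover Q = (\<Union>i. family Q i)"

lemma family_upd [simp]:
  "family (Q(i := Some (X, P, q))) = (family Q)(i := full_paths P)"
  "family (Q(i := None)) = (family Q)(i := {})"
  by (simp_all add: family_def fun_eq_iff)

lemma spec_enqueue_second:
  assumes P: "valid P" and Q: "queue_ok Q N" and disj: "full_paths P \<inter> cover Q = {}"
    and R: "\<And>Q' N' T. queue_ok Q' N' \<Longrightarrow> cover Q' = cover Q \<union> full_paths P \<Longrightarrow> N' \<le> N + 1 \<Longrightarrow>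
      T \<le> time_second + 1 \<Longrightarrow> R (Q', N') T"
  shows "spec (enqueue_second G c vs es t P (Q, N)) R"
proof -
  let ?f = "\<lambda>r. case r of None \<Rightarrow> ret (Q, N)
     | Some (x, q) \<Rightarrow> do { Q \<leftarrow> pq_put N (prefix_cost P + x, P, q) Q; ret (Q, N + 1) }"
  have "spec (do { H \<leftarrow> subgraph_adj G vs es (rev_prefix P) (blocked P);
     bda_2ssp G c H (source P) t (suffix P) }) (\<lambda>r T. spec (?f r) (\<lambda>y T'. R y (T + T')))"
  proof (rule spec_solve[OF P])
    fix q T assume q: "second P q" and T: "T \<le> time_second"
    let ?Q = "Q(N := Some (awalk_cost c (pre P @ q), P, q))"
    have N: "Q N = None" using Q by (auto simp: queue_ok_def)
    then have N': "family Q N = {}" by (simp add: family_def)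
    have cover: "cover ?Q = cover Q \<union> full_paths P"
      using N' by (auto simp: cover_def split: if_splits)
    have "disjoint_family (family Q)" using Q by (simp add: queue_ok_def)
    moreover have "family Q i \<inter> full_paths P = {}" for i
      using disj by (auto simp: cover_def)
    ultimately have "disjoint_family (family ?Q)"
      by (simp add: disjoint_family_on_def) blast
    then have "queue_ok ?Q (N + 1)"
      using Q P q by (auto simp: queue_ok_def less_Suc_eq)
    then have "R (?Q, N + 1) (T + 1)"
      using cover T by (intro R) auto
    then show "spec (?f (Some (awalk_cost c q, q))) (\<lambda>y T'. R y (T + T'))"
      using P by (simp add: valid_def)
  next
    fix T assume "open_paths P = {}" "T \<le> time_second"
    then show "spec (?f None) (\<lambda>y T'. R y (T + T'))"
      using Q by (auto simp: full_paths_def intro!: R)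
  qed
  then show ?thesis
    unfolding enqueue_second_def prod.case spec_bind by (simp add: add.assoc)
qed

lemma spec_split_deviation:
  assumes "d \<noteq> e"
  shows "spec (split_deviation c rp z (x @ e # p) (x @ d # q)) R \<longleftrightarrow>
    R (rev x @ rp, z + awalk_cost c x, d # q) (length x)"
proof -
  let ?b = "\<lambda>(rp, z, p, q). p \<noteq> [] \<and> q \<noteq> [] \<and> hd p = hd q"
  let ?f = "\<lambda>(rp, z, p, q). ret (hd q # rp, z + c (hd q), tl p, tl q)"
  have "while_timed ?b ?f (rp, z, x @ e # p, x @ d # q) =
      Halts (rev x @ rp, z + awalk_cost c x, e # p, d # q) (length x)"
  proof (induction x arbitrary: rp z)
    case Nil
    then show ?case by (subst while_timed_unfold) (simp add: ret_def assms[symmetric])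
  next
    case (Cons a x)
    from Cons[of "a # rp" "z + c a"] show ?case
      by (subst while_timed_unfold) (simp add: ret_def tick_def add.assoc)
  qed
  then show ?thesis by (simp add: split_deviation_def) (simp add: spec_def ret_def)
qed

definition state_ok :: "nat \<Rightarrow> 'a list list \<times> (nat, ('v, 'a) candidate) pq \<times> nat \<Rightarrow> bool" where
  "state_ok i = (\<lambda>(ps, Q, N). length ps = i \<and> distinct ps \<and> queue_ok Q N \<and> N \<le> 2 * i \<and>
    {p. apath s p t} = set ps \<union> cover Q \<and> set ps \<inter> cover Q = {} \<and>
    sorted_wrt (\<lambda>p q. awalk_cost c q \<le> awalk_cost c p) ps \<and>
    (\<forall>p\<in>set ps. \<forall>r\<in>cover Q. awalk_cost c p \<le> awalk_cost c r))"

definition time_step :: "nat \<Rightarrow> nat" where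
  "time_step k = floorlog 2 (2 * k) + 2 * n + 2 * time_second + 3"

lemma spec_kssp_step:
  assumes st: "state_ok i (ps, Q, N)" and i: "i < card {p. apath s p t}" "i \<le> k"
  shows "spec (kssp_step G c vs es t (ps, Q, N)) (\<lambda>st T. state_ok (Suc i) st \<and> T \<le> time_step k)"
proof -
  have Q: "queue_ok Q N" and len: "length ps = i" "distinct ps" and N: "N \<le> 2 * i"
    and all: "{p. apath s p t} = set ps \<union> cover Q" and disj: "set ps \<inter> cover Q = {}"
    and sorted: "sorted_wrt (\<lambda>p q. awalk_cost c q \<le> awalk_cost c p) ps"
    and le: "\<forall>p\<in>set ps. \<forall>r\<in>cover Q. awalk_cost c p \<le> awalk_cost c r"
    using st by (auto simp: state_ok_def)
  have dom: "dom Q \<subseteq> {..<N}" using Q by (simp add: queue_ok_def)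
  then have fin: "finite (dom Q)" by (rule finite_subset) simp
  have "cover Q \<noteq> {}"
    using i(1) len distinct_card[of ps] unfolding all by auto
  then have ne: "\<not> pq_is_empty Q"
    by (auto simp: cover_def family_def pq_is_empty_def pq_empty_def)
  have "card (dom Q) \<le> card {..<N}" using dom by (intro card_mono) auto
  then have fl: "floorlog 2 (card (dom Q)) \<le> floorlog 2 (2 * k)"
    using N i(2) by (intro floorlog_mono) simp
  show ?thesis
    unfolding kssp_step_def prod.case if_not_P[OF ne] spec_bind
  proof (rule spec_pq_extract_min[OF fin ne], goal_cases)
    case (1 j cand)
    obtain X P q where cand: "cand = (X, P, q)" by (cases cand)
    have j: "Q j = Some (X, P, q)" using 1(1) cand by simp
    have P: "valid P" and q: "second P q" and X: "X = awalk_cost c (pre P @ q)"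
      using Q j by (auto simp: queue_ok_def)
    let ?Q = "Q(j := None)" and ?new = "pre P @ q"
    have fam: "family Q j = full_paths P" using j by (simp add: family_def)
    have cover: "cover Q = full_paths P \<union> cover ?Q"
      using fam by (auto simp: cover_def split: if_splits)
    have "disjoint_family (family Q)" using Q by (simp add: queue_ok_def)
    then have disj_fam: "family Q i \<inter> family Q j = {}" if "i \<noteq> j" for i j
      using that by (simp add: disjoint_family_on_def)
    then have disjQ: "disjoint_family (family ?Q)"
      by (simp add: disjoint_family_on_def)
    have disj_cover: "full_paths P \<inter> cover ?Q = {}"
      using disj_fam[of _ j] fam by (auto simp: cover_def split: if_splits)
    have Q0: "queue_ok ?Q N" using Q disjQ by (auto simp: queue_ok_def)
    have new_min: "awalk_cost c ?new \<le> awalk_cost c r" if "r \<in> cover Q" for r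
    proof -
      from that obtain j' X' P' q' r' where j': "Q j' = Some (X', P', q')"
        and r': "r' \<in> open_paths P'" "r = pre P' @ r'"
        by (auto simp: cover_def family_def full_paths_def split: option.splits)
      have *: "valid P'" "second P' q'" "X' = awalk_cost c (pre P' @ q')"
        using Q j' by (auto simp: queue_ok_def)
      have "X \<le> X'"
        using 1(2)[OF j'] by (auto simp: cand candidate_key_def lex_le_def)
      also have "\<dots> \<le> awalk_cost c r"
        using second_min[OF *(1,2) r'(1)] by (simp add: * r')
      finally show ?thesis unfolding X .
    qed
    have new_in: "?new \<in> full_paths P" using q by (auto simp: second_def full_paths_def)
    obtain x e p' d q' where x: "suffix P = x @ e # p'" "q = x @ d # q'" "d \<noteq> e"
      using q by (auto simp: second_def open_paths_def deviates_def)
    define P1 where "P1 = P\<lparr> blocked := d # blocked P \<rparr>"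
    define P2 where "P2 = \<lparr> rev_prefix = d # rev x @ rev_prefix P,
      prefix_cost = prefix_cost P + awalk_cost c x + c d, source = head G d, suffix = q', blocked = [] \<rparr>"
    note split = split_valid[OF P q x, folded P1_def P2_def]
    have rev_new: "fold (#) (rev_prefix P) q = ?new" by (simp add: fold_Cons_rev pre_def)
    have "length (pre P @ suffix P) < n"
      using P length_apath_less[of s "pre P @ suffix P" t] by (simp add: valid_def)
    then have length: "length (rev_prefix P) \<le> n" "length x \<le> n" by (simp_all add: pre_def x(1))
    show ?case
      unfolding cand prod.case spec_bind spec_foreach_ret
      unfolding x(1,2)
      unfolding spec_split_deviation[OF x(3)] prod.case Let_def list.sel spec_bind P1_def[symmetric] P2_def[symmetric]
    proof (rule spec_enqueue_second[OF split(1) Q0], goal_cases)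
      case 1
      show ?case using split(3) disj_cover by blast
    next
      case (2 Q1 N1 T1)
      show ?case
        unfolding prod.case spec_bind
      proof (rule spec_enqueue_second[OF split(2) 2(1)], goal_cases)
        case 1
        show ?case using split(3,6) disj_cover 2(2) by blast
      next
        case (2 Q2 N2 T2)
        have cov: "cover Q = insert ?new (cover Q2)" "?new \<notin> cover Q2"
          using \<open>cover Q1 = cover ?Q \<union> full_paths P1\<close> \<open>cover Q2 = cover Q1 \<union> full_paths P2\<close>
            cover split(3-5) new_in disj_cover by blast+
        have "state_ok (Suc i) (?new # ps, Q2, N2)"
          unfolding state_ok_def prod.case
        proof (intro conjI)
          show "{p. apath s p t} = set (?new # ps) \<union> cover Q2" using all cov(1) by auto
          show "set (?new # ps) \<inter> cover Q2 = {}" using disj cov by auto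
          show "distinct (?new # ps)" using len(2) disj cov(1) by auto
          show "N2 \<le> 2 * Suc i" using N \<open>N1 \<le> N + 1\<close> \<open>N2 \<le> N1 + 1\<close> by simp
          show "sorted_wrt (\<lambda>p q. awalk_cost c q \<le> awalk_cost c p) (?new # ps)"
            using sorted le cov(1) by auto
          show "\<forall>p\<in>set (?new # ps). \<forall>r\<in>cover Q2. awalk_cost c p \<le> awalk_cost c r"
            using le new_min cov(1) by auto
        qed (use len 2(1) in simp_all)
        moreover have "1 + floorlog 2 (card (dom Q)) + (length (rev_prefix P) + (length x + (T1 + (T2 + 0)))) \<le> time_step k"
          using fl length \<open>T1 \<le> time_second + 1\<close> \<open>T2 \<le> time_second + 1\<close>
          unfolding time_step_def by simp
        ultimately show ?case
          using rev_new unfolding prod.case spec_ret x(2) by simp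
      qed
    qed
  qed
qed


definition time_kssp :: "nat \<Rightarrow> nat" where
  "time_kssp k = 4 * n + 3 * m + time_bda + time_second + 1 + k * (time_step k + 2)"

lemma state_ok_solution:
  assumes "state_ok k (ps, Q, N)" "0 < k"
  shows "is_kssp_solution G c s t k (rev ps)"
proof -
  have ps: "length ps = k" "distinct ps" and all: "{p. apath s p t} = set ps \<union> cover Q"
    and sorted: "sorted_wrt (\<lambda>p q. awalk_cost c q \<le> awalk_cost c p) ps"
    and le: "\<forall>p\<in>set ps. \<forall>r\<in>cover Q. awalk_cost c p \<le> awalk_cost c r"
    using assms(1) by (auto simp: state_ok_def)
  have "sorted_wrt (\<lambda>p q. awalk_cost c p \<le> awalk_cost c q) (rev ps)"
    using sorted by (simp add: sorted_wrt_rev)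
  then have "awalk_cost c (rev ps ! i) \<le> awalk_cost c (rev ps ! Suc i)" if "Suc i < k" for i
    using that ps(1) by (simp add: sorted_wrt_iff_nth_less)
  moreover have "awalk_cost c (rev ps ! (k - 1)) \<le> awalk_cost c q" if "apath s q t" "q \<notin> set ps" for q
  proof -
    have "rev ps ! (k - 1) \<in> set (rev ps)" using ps(1) assms(2) by (intro nth_mem) simp
    then show ?thesis using le all that by auto
  qed
  ultimately show ?thesis
    using ps all unfolding is_kssp_solution_def by (force simp: not_less)
qed

lemma spec_kssp:
  assumes k: "0 < k" "k \<le> card {p. apath s p t}"
  shows "spec (kssp G vs es s t c k) (\<lambda>ps T. is_kssp_solution G c s t k ps \<and> T \<le> time_kssp k)"
proof -
  obtain w where w: "apath s w t"
    using k by (cases "{p. apath s p t} = {}") auto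
  show ?thesis
    unfolding kssp_def spec_bind
  proof (rule spec_subgraph_adj, goal_cases)
    case (1 H T0)
    have arcs: "set (aa H) = arcs G" using 1(1) by simp
    have search: "search G c H s" using 1(2) s_in .
    have T0: "T0 = 4 * n + 2 * m" using 1(3) by simp
    show ?case
    proof (rule spec_shortest_path[OF search], goal_cases)
      case (2 T1)
      then have "\<not> awalk s w t" unfolding arcs by (auto simp: awalk_def)
      with w show ?case by (simp add: apath_def)
    next
      case (1 x p T1)
      let ?P = "\<lparr> rev_prefix = [], prefix_cost = 0, source = s, suffix = p, blocked = [] \<rparr>"
      have p: "apath s p t" by fact
      have min: "awalk_cost c p \<le> awalk_cost c w" if "awalk s w t" for w
        using that 1(2)[of w] unfolding arcs by (auto simp: awalk_def)
      have valid: "valid ?P"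
        using p s_in min by (auto simp: valid_def pre_def walk_avoiding_def awalk_simps)
      have full: "full_paths ?P = {q. apath s q t} - {p}"
        using deviation_exists[OF p]
        by (auto simp: full_paths_def open_paths_def pre_def) (auto simp: deviates_def)
      have empty: "queue_ok pq_empty 0" "cover pq_empty = {}"
        by (auto simp: queue_ok_def cover_def family_def pq_empty_def disjoint_family_on_def)
      show ?case
        unfolding option.case prod.case spec_bind
      proof (rule spec_enqueue_second[OF valid empty(1)], goal_cases)
        case 1
        show ?case unfolding empty(2) by simp
      next
        case (2 Q N T2)
        have start: "state_ok 1 ([p], Q, N)"
          using 2 p min full by (auto simp: state_ok_def empty apath_def)
        let ?I = "\<lambda>(i, st) T. 0 < i \<and> i \<le> k \<and> state_ok i st \<and> T \<le> i * (time_step k + 1)"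
        show ?case
          unfolding prod.case spec_bind
        proof (rule spec_mono[OF spec_while[where I = ?I and V = "\<lambda>(i, st). k - i"]], goal_cases)
          case 1
          then show ?case using start k by simp
        next
          case (2 st T)
          obtain i ps Q N where st: "st = (i, ps, Q, N)" by (cases st)
          have i: "0 < i" "i < k" and ok: "state_ok i (ps, Q, N)" and T: "T \<le> i * (time_step k + 1)"
            using 2 by (auto simp: st)
          show ?case
            unfolding st prod.case spec_bind
          proof (rule spec_mono[OF spec_kssp_step[OF ok, of k]], goal_cases)
            case (3 st' T')
            then show ?case using i T by simp
          qed (use i k in simp_all)
        next
          case (3 st T)
          obtain i ps Q N where st: "st = (i, ps, Q, N)" by (cases st)
          have i: "i = k" and ok: "state_ok k (ps, Q, N)" and T: "T \<le> k * (time_step k + 1)"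
            using 3 by (auto simp: st)
          have len: "length ps = k" using ok by (simp add: state_ok_def)
          have "fold (#) ps [] = rev ps" by (simp add: fold_Cons_rev)
          moreover have "T0 + (T1 + (T2 + (T + length ps))) \<le> time_kssp k"
            using T0 T len \<open>T1 \<le> _\<close> \<open>T2 \<le> _\<close> unfolding time_kssp_def by (simp add: algebra_simps)
          ultimately show ?case
            using state_ok_solution[OF ok k(1)] unfolding st prod.case spec_foreach_ret by simp
        qed
      qed
    qed
  qed
qed

lemma card_apaths_le: "card {p. apath s p t} \<le> 2 ^ (m * n)"
proof -
  have sum_le: "(\<Sum>i\<le>j. m ^ i) \<le> Suc m ^ j" for j
  proof (induction j)
    case (Suc j)
    have "m * m ^ j \<le> m * Suc m ^ j" by (intro mult_le_mono2 power_mono) auto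
    with Suc have "(\<Sum>i\<le>j. m ^ i) + m * m ^ j \<le> Suc m ^ j + m * Suc m ^ j" by (rule add_mono)
    then show ?case by simp
  qed simp
  have "{p. apath s p t} \<subseteq> {xs. set xs \<subseteq> arcs G \<and> length xs \<le> n}"
    by (auto simp: apath_def awalk_def intro: length_apath[of s _ t])
  then have "card {p. apath s p t} \<le> card {xs. set xs \<subseteq> arcs G \<and> length xs \<le> n}"
    by (intro card_mono finite_lists_length_le) auto
  also have "\<dots> = (\<Sum>i\<le>n. m ^ i)" by (rule card_lists_length_le) simp
  also have "\<dots> \<le> Suc m ^ n" by (rule sum_le)
  also have "\<dots> \<le> (2 ^ m) ^ n"
    by (intro power_mono) (auto simp: Suc_le_eq)
  finally show ?thesis by (simp add: power_mult)
qed

lemma two_vertices: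
  assumes "2 \<le> card {p. apath s p t}"
  shows "2 \<le> n"
proof (rule ccontr)
  assume "\<not> 2 \<le> n"
  have "p = []" if "apath s p t" for p
  proof -
    have "length p = 0" using length_apath_less[OF that] \<open>\<not> 2 \<le> n\<close> by linarith
    then show ?thesis by simp
  qed
  then have "{p. apath s p t} \<subseteq> {[]}" by blast
  then have "card {p. apath s p t} \<le> 1"
    using card_mono[of "{[] :: 'a list}"] by simp
  with assms show False by simp
qed

lemma time_kssp_le:
  assumes k: "2 \<le> k" "k \<le> card {p. apath s p t}"
  shows "real (time_kssp k) \<le> 100 * (real k * real n * (real n * log 2 (real n) + real m))"
proof -
  have n: "2 \<le> n" using k by (intro two_vertices) simp
  define L where "L = log 2 (real n)"
  have L: "1 \<le> L" using n by (simp add: L_def le_log_iff)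
  define X where "X = real n * (real n * L)"
  define Y where "Y = real n * real m"
  have nX: "real n \<le> X"
  proof -
    have "1 * 1 \<le> real n * L" using n L by (intro mult_mono) auto
    then show ?thesis using n by (simp add: X_def)
  qed
  then have X2: "2 \<le> X" using n by linarith
  have LX: "L \<le> X"
  proof -
    have "1 * 1 \<le> real n * real n" using n by (intro mult_mono) auto
    then show ?thesis using L by (simp add: X_def mult_le_cancel_right1 flip: mult.assoc)
  qed
  have mY: "real m \<le> Y" using n by (simp add: Y_def mult_le_cancel_right1)
  have fl: "real (floorlog 2 n) \<le> 2 * L"
    using n L by (simp add: floorlog_def flip: L_def) linarith
  have "real n * (real n * (real (floorlog 2 n) + 3)) \<le> real n * (real n * (5 * L))"
    using fl L by (intro mult_left_mono) auto
  then have "real n * (real n * (real (floorlog 2 n) + 3)) \<le> 5 * X" by (simp add: X_def algebra_simps)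
  moreover have "real time_bda = real n * (real n * (real (floorlog 2 n) + 3)) + 4 * Y +
      real (floorlog 2 n) + 3 * real n + real m + 3"
    by (simp add: max_potential_def time_bda_def Y_def algebra_simps)
  ultimately have bda: "real time_bda \<le> 12 * X + 5 * Y"
    using fl nX LX mY X2 by linarith
  then have second: "real time_second \<le> 18 * X + 9 * Y"
    using nX mY by (simp add: time_second_def)
  have "2 * k \<le> 2 * 2 ^ (m * n)"
    using order_trans[OF k(2) card_apaths_le] by (rule mult_le_mono2)
  also have "\<dots> < (2 :: nat) ^ (m * n + 2)" by simp
  finally have "floorlog 2 (2 * k) \<le> m * n + 2" by (simp add: floorlog_leI)
  then have "real (floorlog 2 (2 * k)) \<le> real (m * n + 2)" by (simp only: of_nat_le_iff)
  then have "real (floorlog 2 (2 * k)) \<le> Y + 2" by (simp add: Y_def mult.commute)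
  then have step: "real (time_step k) + 2 \<le> 43 * X + 19 * Y"
    using second nX X2 by (simp add: time_step_def)
  have "real (time_kssp k) = 4 * real n + 3 * real m + real time_bda + real time_second + 1 +
      real k * (real (time_step k) + 2)"
    by (simp add: time_kssp_def algebra_simps)
  also have "\<dots> \<le> 35 * X + 17 * Y + real k * (43 * X + 19 * Y)"
    using bda second nX mY X2 mult_left_mono[OF step, of "real k"] by simp
  also have "\<dots> \<le> real k * (35 * X + 17 * Y) + real k * (43 * X + 19 * Y)"
    using k(1) X2 mY by (simp add: mult_le_cancel_right1)
  also have "\<dots> = 78 * (real k * X) + 36 * (real k * Y)" by (simp add: algebra_simps)
  also have "\<dots> \<le> 100 * (real k * X) + 100 * (real k * Y)"
    using X2 mY by (intro add_mono mult_right_mono mult_nonneg_nonneg) auto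
  also have "\<dots> = 100 * (real k * real n * (real n * L + real m))"
    by (simp add: X_def Y_def algebra_simps)
  finally show ?thesis unfolding L_def .
qed

end

theorem theorem7:
  "\<exists>C::real. \<forall>(G :: ('v, 'a) pre_digraph) vs es s t (c :: 'a \<Rightarrow> real) (k :: nat).
     fin_digraph G \<longrightarrow>
     distinct vs \<longrightarrow> set vs = verts G \<longrightarrow>
     distinct es \<longrightarrow> set es = arcs G \<longrightarrow>
     s \<in> verts G \<longrightarrow> t \<in> verts G \<longrightarrow>
     (\<forall>a\<in>arcs G. 0 \<le> c a) \<longrightarrow>
     2 \<le> k \<longrightarrow> k \<le> card {p. pre_digraph.apath G s p t} \<longrightarrow>
     (\<exists>ps T. kssp G vs es s t c k = Halts ps T \<and>
        is_kssp_solution G c s t k ps \<and>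
        real T \<le> C * (real k * real (card (verts G)) *
          (real (card (verts G)) * log 2 (real (card (verts G))) + real (card (arcs G)))))"
proof (rule exI[of _ 100], intro allI impI)
  fix G :: "('v, 'a) pre_digraph" and vs es s t and c :: "'a \<Rightarrow> real" and k :: nat
  assume "fin_digraph G" and input: "distinct vs" "set vs = verts G" "distinct es" "set es = arcs G"
    "s \<in> verts G" "t \<in> verts G" "\<forall>a\<in>arcs G. 0 \<le> c a"
    and k: "2 \<le> k" "k \<le> card {p. pre_digraph.apath G s p t}"
  interpret fin_digraph G by fact
  interpret kssp_input G vs es s t c
    using input by unfold_locales auto
  have "spec (kssp G vs es s t c k) (\<lambda>ps T. is_kssp_solution G c s t k ps \<and> T \<le> time_kssp k)"
    using k by (intro spec_kssp) auto
  with time_kssp_le[OF k]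
  show "\<exists>ps T. kssp G vs es s t c k = Halts ps T \<and> is_kssp_solution G c s t k ps \<and>
      real T \<le> 100 * (real k * real (card (verts G)) *
        (real (card (verts G)) * log 2 (real (card (verts G))) + real (card (arcs G))))"
    unfolding spec_def by (fastforce intro: order_trans)
qed

end
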